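(* Let $X$ be a graph of valency $4$ admitting a half-arc-transitive subgroup $G$ of $\mathrm{Aut}\,X$ relative to which it is tightly attached of even radius at least $4$ (that is, $X$ is $G$-tightly attached and its $G$-radius is even and at least $4$). Then $X$ is isomorphic to $\mathcal{X}_e(m,n;r,t)$ for some even $m\ge 4$, some even $n\geq 4$, and some $r\in\mathbb{Z}_n^*$ and $t\in\mathbb{Z}_n$ satisfying $r^m=1$, $t(r-1)=0$ and $1+r+\cdots+r^{m-1}+2t=0$.
   Context: Graphs are finite, simple, connected and undirected. A subgroup $G\le\mathrm{Aut}\,X$ is half-arc-transitive on $X$ if it acts transitively on vertices and on edges of $X$ but not on arcs (ordered pairs of adjacent vertices). Let $G\le \mathrm{Aut}\,X$ be half-arc-transitive on a graph $X$ of valency $4$. Orient one edge and apply $G$ to obtain an orientation $D(X)$ of all edges. A $G$-alternating cycle is a cycle of even length in $X$ whose vertices are alternately the heads and the tails (in $D(X)$) of their two incident edges in the cycle. All $G$-alternating cycles have the same length $2r_G(X)$, $r_G(X)\ge 2$; $r_G(X)$ is the $G$-radius of $X$. Two $G$-alternating cycles are adjacent if they share a vertex; any two adjacent ones have the same number $a_G(X)$ of common vertices, called the $G$-attachment number. $X$ is $G$-tightly attached if $a_G(X)=r_G(X)$. For even integers $m,n\ge 4$ and $r\in\mathbb{Z}_n^*$, $t\in\mathbb{Z}_n$ satisfying $r^m=1$, $t(r-1)=0$ and $1+r+\cdots+r^{m-1}+2t=0$ in $\mathbb{Z}_n$, the graph $\mathcal{X}_e(m,n;r,t)$ has vertex set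 $\{u_i^j : i\in\mathbb{Z}_m, j\in\mathbb{Z}_n\}$ and edges given by: $u_i^j\sim u_{i+1}^j,\ u_{i+1}^{j+r^i}$ for $i\in\mathbb{Z}_m\setminus\{m-1\}$, $j\in\mathbb{Z}_n$; and $u_{m-1}^j\sim u_0^{j+t},\ u_0^{j+r^{m-1}+t}$ for $j\in\mathbb{Z}_n$. *)

theory Defs
  imports
    "Graph_Theory.Graph_Theory"
    "HOL-Algebra.Bij"
    "HOL-Number_Theory.Cong"
begin

text \<open>
  A finite simple undirected graph is a \<open>pair_graph\<close>: a finite, loop-free, symmetric
  digraph without parallel arcs. Its set \<open>parcs X\<close> is the set of arcs (ordered pairs of
  adjacent vertices) of the graph; edges are the corresponding two-element sets.
\<close>

definition edges_of :: "('a \<times> 'a) set \<Rightarrow> 'a set set" where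
  "edges_of A = (\<lambda>(u, v). {u, v}) ` A"

text \<open>As in \<open>BijGroup\<close>, automorphisms are extensional: \<open>undefined\<close> off the vertex set.\<close>

definition automorphisms :: "'a pair_pre_digraph \<Rightarrow> ('a \<Rightarrow> 'a) set" where
  "automorphisms X = {f \<in> Bij (pverts X).
     \<forall>u \<in> pverts X. \<forall>v \<in> pverts X. (f u, f v) \<in> parcs X \<longleftrightarrow> (u, v) \<in> parcs X}"

definition Aut :: "'a pair_pre_digraph \<Rightarrow> ('a \<Rightarrow> 'a) monoid" where
  "Aut X = (BijGroup (pverts X))\<lparr>carrier := automorphisms X\<rparr>"

lemma subgroup_automorphisms: "subgroup (automorphisms X) (BijGroup (pverts X))"
proof -
  let ?B = "BijGroup (pverts X)"
  interpret B: group ?B by (rule group_BijGroup)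
  show ?thesis
  proof (rule B.subgroupI)
    show "automorphisms X \<subseteq> carrier ?B"
      by (auto simp: automorphisms_def BijGroup_def)
    have "(\<lambda>x\<in>pverts X. x) \<in> automorphisms X"
      by (auto simp: automorphisms_def id_Bij)
    then show "automorphisms X \<noteq> {}" by blast
  next
    fix f assume f: "f \<in> automorphisms X"
    then have fB: "f \<in> Bij (pverts X)" by (simp add: automorphisms_def)
    let ?g = "\<lambda>x\<in>pverts X. inv_into (pverts X) f x"
    have gB: "?g \<in> Bij (pverts X)" using fB by (rule restrict_inv_into_Bij)
    have inv: "inv\<^bsub>?B\<^esub> f = ?g" using fB by (rule inv_BijGroup)
    have "?g u \<in> pverts X \<and> f (?g u) = u" if "u \<in> pverts X" for u
      using fB that by (auto simp: Bij_def bij_betw_def inv_into_into f_inv_into_f)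
    then have "?g \<in> automorphisms X"
      using f gB unfolding automorphisms_def by (smt (verit) mem_Collect_eq)
    then show "inv\<^bsub>?B\<^esub> f \<in> automorphisms X" using inv by simp
  next
    fix f g assume fg: "f \<in> automorphisms X" "g \<in> automorphisms X"
    then have B: "f \<in> Bij (pverts X)" "g \<in> Bij (pverts X)"
      by (simp_all add: automorphisms_def)
    have eq: "f \<otimes>\<^bsub>?B\<^esub> g = compose (pverts X) f g"
      using B by (simp add: BijGroup_def)
    have "g u \<in> pverts X" if "u \<in> pverts X" for u
      using B(2) that Bij_imp_funcset by blast
    then have "compose (pverts X) f g \<in> automorphisms X"
      using fg B by (auto simp: automorphisms_def compose_Bij compose_eq)
    then show "f \<otimes>\<^bsub>?B\<^esub> g \<in> automorphisms X" using eq by simp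
  qed
qed

lemma group_Aut: "group (Aut X)"
  unfolding Aut_def
  by (rule group.subgroup_imp_group[OF group_BijGroup subgroup_automorphisms])

definition transitive_on :: "'g set \<Rightarrow> ('g \<Rightarrow> 'b \<Rightarrow> 'b) \<Rightarrow> 'b set \<Rightarrow> bool" where
  "transitive_on G act S \<longleftrightarrow> (\<forall>x \<in> S. \<forall>y \<in> S. \<exists>g \<in> G. act g x = y)"

definition half_arc_transitive :: "'a pair_pre_digraph \<Rightarrow> ('a \<Rightarrow> 'a) set \<Rightarrow> bool" where
  "half_arc_transitive X G \<longleftrightarrow> subgroup G (Aut X) \<and>
     transitive_on G (\<lambda>g v. g v) (pverts X) \<and>
     transitive_on G (\<lambda>g e. g ` e) (edges_of (parcs X)) \<and>
     \<not> transitive_on G (\<lambda>g (u, v). (g u, g v)) (parcs X)"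

text \<open>
  The orientation obtained by choosing an orientation \<open>(u, v)\<close> of one edge and applying \<open>G\<close>.
  It depends on the choice only up to reversing all arcs, which does not affect the
  notion of alternating cycle.
\<close>

definition orientation :: "'a pair_pre_digraph \<Rightarrow> ('a \<Rightarrow> 'a) set \<Rightarrow> ('a \<times> 'a) set \<Rightarrow> bool" where
  "orientation X G D \<longleftrightarrow> (\<exists>(u, v) \<in> parcs X. D = {(g u, g v) | g. g \<in> G})"

text \<open>
  Cycles are given by the closed list of arcs traversed. The bound on the length excludes
  the back-and-forth walks of length 2, which \<open>pre_digraph.cycle\<close> admits. The vertices of
  the cycle in order are \<open>map fst p\<close>; \<open>u\<close>, \<open>v\<close>, \<open>w\<close> below are three consecutive ones.
\<close>

definition alternating_cycle ::
  "'a pair_pre_digraph \<Rightarrow> ('a \<Rightarrow> 'a) set \<Rightarrow> ('a \<times> 'a) list \<Rightarrow> bool" where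
  "alternating_cycle X G p \<longleftrightarrow>
     pre_digraph.cycle (with_proj X) p \<and> length p > 2 \<and> even (length p) \<and>
     (\<exists>D parity. orientation X G D \<and>
        (\<forall>i < length p.
           let u = fst (p ! ((i + length p - 1) mod length p));
               v = fst (p ! i);
               w = fst (p ! ((i + 1) mod length p))
           in if even i = parity
              then (v, u) \<in> D \<and> (v, w) \<in> D
              else (u, v) \<in> D \<and> (w, v) \<in> D))"

definition cycle_verts :: "('a \<times> 'a) list \<Rightarrow> 'a set" where
  "cycle_verts p = fst ` set p"

definition radius :: "'a pair_pre_digraph \<Rightarrow> ('a \<Rightarrow> 'a) set \<Rightarrow> nat" where
  "radius X G = (THE r. \<exists>p. alternating_cycle X G p \<and> length p = 2 * r)"

text \<open>
  Arc lists that differ by rotation or reversal represent the same cycle, so two cycles are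
  distinguished by their edge sets. (Distinct ones may well have equal vertex sets.)
\<close>

definition adjacent_alternating_cycles ::
  "'a pair_pre_digraph \<Rightarrow> ('a \<Rightarrow> 'a) set \<Rightarrow> ('a \<times> 'a) list \<Rightarrow> ('a \<times> 'a) list \<Rightarrow> bool" where
  "adjacent_alternating_cycles X G p q \<longleftrightarrow>
     alternating_cycle X G p \<and> alternating_cycle X G q \<and>
     edges_of (set p) \<noteq> edges_of (set q) \<and> cycle_verts p \<inter> cycle_verts q \<noteq> {}"

definition attachment_number :: "'a pair_pre_digraph \<Rightarrow> ('a \<Rightarrow> 'a) set \<Rightarrow> nat" where
  "attachment_number X G = (THE a. \<exists>p q.
     adjacent_alternating_cycles X G p q \<and> card (cycle_verts p \<inter> cycle_verts q) = a)"

definition tightly_attached :: "'a pair_pre_digraph \<Rightarrow> ('a \<Rightarrow> 'a) set \<Rightarrow> bool" where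
  "tightly_attached X G \<longleftrightarrow> attachment_number X G = radius X G"

text \<open>
  The graph $\mathcal{X}_e(m,n;r,t)$: the vertex $u_i^j$ is the pair \<open>(i, j)\<close>, where residues
  modulo \<open>m\<close> and \<open>n\<close> are represented by \<open>{0..<m}\<close> and \<open>{0..<n}\<close>.
\<close>

definition Xe_half_arcs ::
  "nat \<Rightarrow> nat \<Rightarrow> int \<Rightarrow> int \<Rightarrow> ((nat \<times> int) \<times> (nat \<times> int)) set" where
  "Xe_half_arcs m n r t =
     (\<Union>i \<in> {0..<m - 1}. \<Union>j \<in> {0..<int n}.
        {((i, j), (i + 1, j)), ((i, j), (i + 1, (j + r ^ i) mod int n))}) \<union>
     (\<Union>j \<in> {0..<int n}.
        {((m - 1, j), (0, (j + t) mod int n)),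
         ((m - 1, j), (0, (j + r ^ (m - 1) + t) mod int n))})"

definition Xe :: "nat \<Rightarrow> nat \<Rightarrow> int \<Rightarrow> int \<Rightarrow> (nat \<times> int) pair_pre_digraph" where
  "Xe m n r t =
     \<lparr>pverts = {0..<m} \<times> {0..<int n}, parcs = Xe_half_arcs m n r t \<union> (Xe_half_arcs m n r t)\<inverse>\<rparr>"

end

theory Submission
  imports Defs "HOL-Combinatorics.Cycles"
begin

text \<open>
  In the orientation \<open>D\<close> every vertex has two out- and two in-neighbours, and \<open>G\<close> is transitive on
  \<open>D\<close>. Hence every alternating cycle has rotations, and reflections at each of its vertices, induced
  by \<open>G\<close>. Tight attachment then means that the heads of each alternating cycle are exactly the
  tails of the next one, so that the vertices fall into cyclically arranged blocks of size \<open>n\<close>,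
  the radius, and an element of \<open>G\<close> fixing an arc is trivial.

  Fix an arc \<open>(u, v)\<close>, let \<open>\<rho>\<close> be the rotation of its alternating cycle by one tail, let \<open>\<tau>\<close> be
  the reflection at \<open>u\<close>, and let \<open>\<sigma>\<close> map \<open>u\<close> to \<open>v\<close>. Then \<open>\<sigma> \<rho> \<sigma>\<inverse> = \<rho>\<^sup>r\<close>, and the vertices
  are \<open>\<rho>\<^sup>j \<sigma>\<^sup>i u\<close>, which is \<open>u\<^sub>i\<^sup>j\<close> in the notation of the paper. With \<open>\<sigma>\<^sup>m u = \<rho>\<^sup>t u\<close>,
  comparing \<open>\<tau> \<sigma>\<^sup>m u\<close> computed in two ways gives \<open>1 + r + \<dots> + r\<^sup>m\<^sup>-\<^sup>1 + 2 t = 0\<close>, whence \<open>m\<close> is even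
  because \<open>n\<close> is; and \<open>\<sigma>\<^sup>m = \<rho>\<^sup>t\<close> gives \<open>r\<^sup>m = 1\<close> and \<open>t (r - 1) = 0\<close>.
\<close>

section \<open>Alternating walks in half-arc-transitive digraphs\<close>

text \<open>
  \<open>tail_class D x\<close> is the set of tails of the alternating cycle on which \<open>x\<close> is a tail;
  \<open>tail_class (D\<inverse>) x\<close> is the set of heads of the one on which \<open>x\<close> is a head.
\<close>

definition tail_class :: "('a \<times> 'a) set \<Rightarrow> 'a \<Rightarrow> 'a set" where
  "tail_class D x = (D O D\<inverse>)\<^sup>* `` {x}"

text \<open>A cycle is encoded as a periodic sequence on all naturals, started at a tail, so that no
  index needs reducing modulo \<open>L\<close>.\<close>

definition alternating_sequence :: "('a \<times> 'a) set \<Rightarrow> (nat \<Rightarrow> 'a) \<Rightarrow> nat \<Rightarrow> bool" where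
  "alternating_sequence D y L \<longleftrightarrow> even L \<and> L > 2 \<and> (\<forall>i. y (i + L) = y i) \<and> inj_on y {..<L} \<and>
     (\<forall>i. (y (2 * i), y (2 * i + 1)) \<in> D \<and> (y (2 * i + 2), y (2 * i + 1)) \<in> D)"

lemma tail_class_self [simp]: "x \<in> tail_class D x"
  by (simp add: tail_class_def)

lemma tail_class_closed: "D\<inverse> `` (D `` tail_class D x) \<subseteq> tail_class D x"
  by (auto simp: tail_class_def) (meson converse_iff relcomp.relcompI rtrancl.rtrancl_into_rtrancl)

lemma tail_class_minimal:
  assumes "x \<in> A" "D\<inverse> `` (D `` A) \<subseteq> A"
  shows "tail_class D x \<subseteq> A"
proof
  fix z assume "z \<in> tail_class D x"
  then have "(x, z) \<in> (D O D\<inverse>)\<^sup>*" by (simp add: tail_class_def)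
  then show "z \<in> A"
    by induction (use assms in \<open>auto simp: subset_iff\<close>)
qed

text \<open>The relation \<open>D O D\<inverse>\<close> is symmetric, so its reflexive transitive
  closure is an equivalence and the tail classes are its blocks.\<close>

lemma tail_class_eq:
  assumes "y \<in> tail_class D x"
  shows "tail_class D y = tail_class D x"
proof -
  have sym: "sym ((D O D\<inverse>)\<^sup>*)"
    by (rule sym_rtrancl) (auto simp: sym_def)
  have "(x, y) \<in> (D O D\<inverse>)\<^sup>*" "(y, x) \<in> (D O D\<inverse>)\<^sup>*"
    using assms sym by (auto simp: tail_class_def sym_def)
  then show ?thesis
    by (auto simp: tail_class_def)
qed

lemma tail_class_disjoint:
  assumes "z \<in> tail_class D x" "z \<in> tail_class D y"
  shows "tail_class D x = tail_class D y"
  using assms tail_class_eq by metis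

text \<open>Both sides are the heads of the alternating cycle through \<open>(x, y)\<close>; each
  inclusion is minimality of a class against a set closed under the double step.\<close>

lemma out_tail_class:
  assumes "(x, y) \<in> D"
  shows "D `` tail_class D x = tail_class (D\<inverse>) y"
proof
  let ?H = "tail_class (D\<inverse>) y"
  have clH: "D `` (D\<inverse> `` ?H) \<subseteq> ?H"
    using tail_class_closed[of "D\<inverse>" y] by simp
  have "tail_class D x \<subseteq> {x'. D `` {x'} \<subseteq> ?H}"
  proof (rule tail_class_minimal)
    show "x \<in> {x'. D `` {x'} \<subseteq> ?H}"
      using assms clH tail_class_self[of y "D\<inverse>"] by blast
    show "D\<inverse> `` (D `` {x'. D `` {x'} \<subseteq> ?H}) \<subseteq> {x'. D `` {x'} \<subseteq> ?H}"
      using clH by blast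
  qed
  then show "D `` tail_class D x \<subseteq> ?H" by blast
  show "?H \<subseteq> D `` tail_class D x"
    by (rule tail_class_minimal)
      (use assms tail_class_closed[of D x] tail_class_self[of x D] in \<open>auto simp del: tail_class_self\<close>)
qed

lemma card_relation_const:
  assumes "finite A" "finite D" "D \<subseteq> A \<times> UNIV" "\<And>x. x \<in> A \<Longrightarrow> card (D `` {x}) = c"
  shows "card D = c * card A"
proof -
  have "D = (SIGMA x:A. D `` {x})" using assms(3) by auto
  moreover have "card (SIGMA x:A. D `` {x}) = (\<Sum>x\<in>A. card (D `` {x}))"
    by (rule card_SigmaI) (use assms in \<open>auto intro: finite_Image\<close>)
  ultimately have "card D = (\<Sum>x\<in>A. card (D `` {x}))" by simp
  then show ?thesis using assms(4) by simp
qed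

text \<open>Finite order brings \<open>u\<close> back to itself, and injectivity of the powers turns
  any coincidence on the orbit into an earlier return; so the least return time is the orbit
  size.\<close>

lemma funpow_orbit:
  fixes u :: 'a
  assumes "f permutes V" "finite V"
  defines "n \<equiv> card (range (\<lambda>j. (f ^^ j) u))"
  shows "n > 0" and "(f ^^ n) u = u" and "inj_on (\<lambda>j. (f ^^ j) u) {..<n}"
    and "range (\<lambda>j. (f ^^ j) u) = (\<lambda>j. (f ^^ j) u) ` {..<n}"
proof -
  obtain N where N: "f ^^ N = id" "N > 0"
    using permutation_is_nilpotent assms unfolding permutation_permutes by metis
  define k where "k = (LEAST k. k > 0 \<and> (f ^^ k) u = u)"
  have k: "k > 0" "(f ^^ k) u = u"
    using LeastI[of "\<lambda>k. k > 0 \<and> (f ^^ k) u = u" N] N by (auto simp: k_def)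
  have min: "k \<le> l" if "l > 0" "(f ^^ l) u = u" for l
    using that unfolding k_def by (intro Least_le) auto
  have injf: "inj (f ^^ i)" for i
    using assms(1) by (meson inj_fn permutes_inj)
  have inj: "inj_on (\<lambda>j. (f ^^ j) u) {..<k}"
  proof (rule linorder_inj_onI')
    fix i j assume ij: "i \<in> {..<k}" "j \<in> {..<k}" "i < j"
    show "(f ^^ i) u \<noteq> (f ^^ j) u"
    proof
      assume "(f ^^ i) u = (f ^^ j) u"
      also have "(f ^^ j) u = (f ^^ i) ((f ^^ (j - i)) u)"
        using ij by (metis add_diff_inverse_nat comp_apply funpow_add less_imp_le_nat not_less)
      finally have "(f ^^ (j - i)) u = u" using injf by (metis injD)
      then show False using min[of "j - i"] ij by auto
    qed
  qed
  have rng: "range (\<lambda>j. (f ^^ j) u) = (\<lambda>j. (f ^^ j) u) ` {..<k}"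
  proof -
    have "(f ^^ j) u \<in> (\<lambda>j. (f ^^ j) u) ` {..<k}" for j
      using funpow_mod_eq[OF k(2), of j] k(1) by (metis imageI lessThan_iff mod_less_divisor)
    then show ?thesis by auto
  qed
  have "n = k" unfolding n_def rng using card_image[OF inj] by simp
  then show "n > 0" "(f ^^ n) u = u" "inj_on (\<lambda>j. (f ^^ j) u) {..<n}"
    "range (\<lambda>j. (f ^^ j) u) = (\<lambda>j. (f ^^ j) u) ` {..<n}"
    using k inj rng by auto
qed

text \<open>The elements of \<open>P\<close> are permutations of the whole type fixing everything
  outside \<open>V\<close>, so that composition and inverse are the ordinary ones.
  \<open>connected\<close> is weak connectedness phrased through closed sets.\<close>

locale half_arc_digraph =
  fixes V :: "'a set" and D :: "('a \<times> 'a) set" and P :: "('a \<Rightarrow> 'a) set"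
  assumes finite_V: "finite V" and V_nonempty: "V \<noteq> {}" and D_subset: "D \<subseteq> V \<times> V"
    and permutes: "f \<in> P \<Longrightarrow> f permutes V"
    and comp_closed: "f \<in> P \<Longrightarrow> g \<in> P \<Longrightarrow> f \<circ> g \<in> P"
    and inv_closed: "f \<in> P \<Longrightarrow> inv_into UNIV f \<in> P"
    and preserves: "f \<in> P \<Longrightarrow> (x, y) \<in> D \<Longrightarrow> (f x, f y) \<in> D"
    and arc_transitive: "(x, y) \<in> D \<Longrightarrow> (x', y') \<in> D \<Longrightarrow> \<exists>f\<in>P. f x = x' \<and> f y = y'"
    and out_two: "x \<in> V \<Longrightarrow> card (D `` {x}) = 2"
    and in_two: "x \<in> V \<Longrightarrow> card (D\<inverse> `` {x}) = 2"
    and asymmetric: "(x, y) \<in> D \<Longrightarrow> (y, x) \<notin> D"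
    and connected: "S \<subseteq> V \<Longrightarrow> S \<noteq> {} \<Longrightarrow> D `` S \<subseteq> S \<Longrightarrow> D\<inverse> `` S \<subseteq> S \<Longrightarrow> S = V"
begin

abbreviation T where "T \<equiv> tail_class D"
abbreviation H where "H \<equiv> tail_class (D\<inverse>)"

text \<open>The axioms are symmetric under reversal of all arcs, so each result about tails yields
  one about heads.\<close>

lemma dual: "half_arc_digraph V (D\<inverse>) P"
proof
  show "\<exists>f\<in>P. f x = x' \<and> f y = y'" if "(x, y) \<in> D\<inverse>" "(x', y') \<in> D\<inverse>" for x y x' y'
    using arc_transitive[of y x y' x'] that by blast
qed (use finite_V V_nonempty D_subset permutes comp_closed inv_closed preserves out_two in_two
    asymmetric connected in auto)

lemma inj_P: "f \<in> P \<Longrightarrow> inj f"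
  using permutes permutes_inj by blast

lemma surj_P: "f \<in> P \<Longrightarrow> surj f"
  using permutes permutes_surj by blast

lemma in_V: "f \<in> P \<Longrightarrow> f x \<in> V \<longleftrightarrow> x \<in> V"
  by (rule permutes_in_image[OF permutes])

lemma arc_V: "(x, y) \<in> D \<Longrightarrow> x \<in> V \<and> y \<in> V"
  using D_subset by auto

lemma inv_P [simp]: "f \<in> P \<Longrightarrow> inv_into UNIV f (f x) = x" "f \<in> P \<Longrightarrow> f (inv_into UNIV f x) = x"
  by (simp_all add: inj_P surj_P surj_f_inv_f)

lemma preserves_iff: "f \<in> P \<Longrightarrow> (f x, f y) \<in> D \<longleftrightarrow> (x, y) \<in> D"
  using preserves preserves[OF inv_closed, of f "f x" "f y"] by auto

lemma image_out: assumes f: "f \<in> P" shows "f ` (D `` A) = D `` (f ` A)"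
proof
  show "f ` (D `` A) \<subseteq> D `` (f ` A)" using preserves[OF f] by (force simp: Image_iff)
  show "D `` (f ` A) \<subseteq> f ` (D `` A)"
  proof
    fix z assume "z \<in> D `` (f ` A)"
    then obtain a where "a \<in> A" "(f a, z) \<in> D" by auto
    then have "(a, inv_into UNIV f z) \<in> D" using f preserves_iff[OF f, of a "inv_into UNIV f z"] by simp
    then show "z \<in> f ` (D `` A)" using f \<open>a \<in> A\<close>
      by (intro image_eqI[of _ _ "inv_into UNIV f z"]) auto
  qed
qed

lemma finite_D: "finite D"
  using finite_V D_subset finite_subset by blast

lemma out_arc: assumes "x \<in> V" obtains y where "(x, y) \<in> D"
proof -
  have "D `` {x} \<noteq> {}" using out_two[OF assms] by force
  then show ?thesis using that by auto
qed

lemma out_pair: "(x, y) \<in> D \<Longrightarrow> (x, z) \<in> D \<Longrightarrow> y \<noteq> z \<Longrightarrow> D `` {x} = {y, z}"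
  using out_two[of x] arc_V[of x y] by (intro card_seteq[symmetric]) (auto intro: card_ge_0_finite)

lemma other_out: assumes "(x, y) \<in> D" obtains z where "z \<noteq> y" "D `` {x} = {y, z}"
proof -
  have "card (D `` {x}) = 2" using out_two arc_V assms by blast
  then have "\<not> D `` {x} \<subseteq> {y}" using card_mono[of "{y}" "D `` {x}"] by auto
  then obtain z where "z \<noteq> y" "(x, z) \<in> D" by auto
  then show ?thesis using that out_pair[OF assms] by metis
qed

lemma in_pair: "(y, x) \<in> D \<Longrightarrow> (z, x) \<in> D \<Longrightarrow> y \<noteq> z \<Longrightarrow> D\<inverse> `` {x} = {y, z}"
  using half_arc_digraph.out_pair[OF dual, of x y z] by simp

lemma other_in: assumes "(y, x) \<in> D" obtains z where "z \<noteq> y" "D\<inverse> `` {x} = {y, z}"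
  using half_arc_digraph.other_out[OF dual, of x y] assms by auto

lemma id_P: "id \<in> P"
proof -
  obtain x where "x \<in> V" using V_nonempty by auto
  then obtain y where "(x, y) \<in> D" using out_arc by blast
  then obtain f where f: "f \<in> P" using arc_transitive by blast
  then have "inv_into UNIV f \<circ> f \<in> P" using comp_closed inv_closed by blast
  then show ?thesis using inj_P[OF f] by simp
qed

lemma funpow_P: "f \<in> P \<Longrightarrow> f ^^ j \<in> P"
  by (induction j) (auto simp: id_P[unfolded id_def] comp_closed id_P)

lemma vertex_transitive: assumes "x \<in> V" "y \<in> V" shows "\<exists>f\<in>P. f x = y"
  using assms by (metis arc_transitive out_arc)

lemma tail_class_V: "x \<in> V \<Longrightarrow> T x \<subseteq> V"
  by (rule tail_class_minimal) (use D_subset in auto)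

lemma tail_class_image: assumes f: "f \<in> P" shows "f ` T x = T (f x)"
proof -
  have *: "T (f x) \<subseteq> f ` T x" if f: "f \<in> P" for f x
  proof (rule tail_class_minimal)
    show "D\<inverse> `` (D `` (f ` T x)) \<subseteq> f ` T x"
      using half_arc_digraph.image_out[OF dual f] image_out[OF f] tail_class_closed[of D x]
      by (metis image_mono)
  qed simp
  have "T x \<subseteq> inv_into UNIV f ` T (f x)"
    using *[OF inv_closed[OF f], of "f x"] f by simp
  then have "f ` T x \<subseteq> T (f x)" using f by (force simp: subset_iff)
  then show ?thesis using * f by blast
qed

lemma card_tail_class: assumes "x \<in> V" "y \<in> V" shows "card (T x) = card (T y)"
proof -
  obtain f where "f \<in> P" "f x = y" using vertex_transitive assms by blast
  then show ?thesis
    using tail_class_image card_image[of f "T x"] inj_P inj_on_subset by (metis subset_UNIV)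
qed

lemma finite_tail_class: "x \<in> V \<Longrightarrow> finite (T x)"
  using tail_class_V finite_V finite_subset by metis

lemma card_arcs_from: assumes "A \<subseteq> V" shows "card (D \<inter> A \<times> UNIV) = 2 * card A"
proof (rule card_relation_const)
  show "finite A" using assms finite_V finite_subset by blast
  show "card ((D \<inter> A \<times> UNIV) `` {x}) = 2" if "x \<in> A" for x
  proof -
    have "(D \<inter> A \<times> UNIV) `` {x} = D `` {x}" using that by auto
    then show ?thesis using out_two that assms by auto
  qed
qed (use finite_D in auto)

lemma card_arcs_into: assumes "A \<subseteq> V" shows "card (D \<inter> UNIV \<times> A) = 2 * card A"
proof -
  have "D \<inter> UNIV \<times> A = (D\<inverse> \<inter> A \<times> UNIV)\<inverse>" by auto
  then show ?thesis
    using half_arc_digraph.card_arcs_from[OF dual assms] by (metis card_inverse)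
qed

text \<open>Equal in- and out-degrees make every forward closed set backward closed as well.\<close>

lemma connected_forward: assumes "S \<subseteq> V" "S \<noteq> {}" "D `` S \<subseteq> S" shows "S = V"
proof -
  have "D \<inter> S \<times> UNIV = D \<inter> UNIV \<times> S"
    by (rule card_seteq) (use assms finite_D card_arcs_from card_arcs_into in auto)
  then have "D\<inverse> `` S \<subseteq> S" by blast
  then show ?thesis using connected assms by blast
qed

text \<open>The arcs leaving \<open>T x\<close> are precisely those entering its out-neighbours, and
  each vertex on either side carries two of them.\<close>

lemma card_out_tail_class: assumes "x \<in> V" shows "card (D `` T x) = card (T x)"
proof -
  have "D \<inter> T x \<times> UNIV = D \<inter> UNIV \<times> (D `` T x)"
    using tail_class_closed[of D x] by blast
  moreover have "D `` T x \<subseteq> V" using D_subset by auto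
  ultimately show ?thesis
    using card_arcs_from[OF tail_class_V[OF assms]] card_arcs_into[of "D `` T x"] by simp
qed

text \<open>Arc-transitivity gives an element fixing \<open>u\<close> and moving \<open>v\<close> to
  the other out-neighbour; injectivity forces it to swap the two.\<close>

lemma reflection:
  assumes "(u, v) \<in> D"
  obtains \<tau> where "\<tau> \<in> P" "\<tau> u = u" "\<tau> v \<noteq> v" "D `` {u} = {v, \<tau> v}" "\<tau> (\<tau> v) = v"
proof -
  obtain w where w: "w \<noteq> v" "D `` {u} = {v, w}" using other_out assms by blast
  then obtain \<tau> where \<tau>: "\<tau> \<in> P" "\<tau> u = u" "\<tau> v = w"
    using arc_transitive[OF assms, of u w] by auto
  have "\<tau> w \<in> {v, w}" using w \<tau> preserves[of \<tau> u w] by auto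
  moreover have "\<tau> w \<noteq> w" using w \<tau> inj_P[of \<tau>] by (metis injD)
  ultimately show ?thesis using that w \<tau> by auto
qed

text \<open>On the walk \<open>v\<close>, \<open>u\<close>, \<open>w\<close>, \<open>u'\<close> the
  arcs \<open>(u, v)\<close> and \<open>(u', w)\<close> differ by a shift of two steps;
  arc-transitivity carries the first to the second.\<close>

lemma rotation:
  assumes "(u, v) \<in> D"
  obtains \<rho> where "\<rho> \<in> P" "\<rho> v \<noteq> v" "\<rho> u \<noteq> u" "D `` {u} = {v, \<rho> v}" "D\<inverse> `` {\<rho> v} = {u, \<rho> u}"
proof -
  obtain w where w: "w \<noteq> v" "D `` {u} = {v, w}" using other_out assms by blast
  then have "(u, w) \<in> D" by auto
  then obtain u' where u': "u' \<noteq> u" "D\<inverse> `` {w} = {u, u'}" using other_in by blast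
  then have "(u', w) \<in> D" by auto
  then obtain \<rho> where "\<rho> \<in> P" "\<rho> u = u'" "\<rho> v = w"
    using arc_transitive[OF assms] by blast
  then show ?thesis using that w u' by auto
qed

text \<open>A vertex has two out- and two in-neighbours, so fixing one of a pair fixes the other,
  and fixedness travels along the alternating walk.\<close>

lemma fixes_class:
  assumes f: "f \<in> P" and "(x, y) \<in> D" "f x = x" "f y = y" and z: "z \<in> T x \<union> D `` T x"
  shows "f z = z"
proof -
  let ?A = "{x \<in> V. f x = x \<and> (\<forall>y\<in>D `` {x}. f y = y)}"
  have out: "\<forall>y\<in>D `` {x}. f y = y" if arc: "(x, y) \<in> D" "f x = x" "f y = y" for x y
  proof -
    obtain z where z: "z \<noteq> y" "D `` {x} = {y, z}" by (rule other_out[OF arc(1)])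
    then have "f z \<in> {y, z}" using preserves[OF f, of x z] that by auto
    moreover have "f z \<noteq> y" using inj_P[OF f] that z by (metis injD)
    ultimately show ?thesis using z that by auto
  qed
  have "in": "\<forall>x\<in>D\<inverse> `` {y}. f x = x" if arc: "(x, y) \<in> D" "f x = x" "f y = y" for x y
  proof -
    obtain z where z: "z \<noteq> x" "D\<inverse> `` {y} = {x, z}" by (rule other_in[OF arc(1)])
    then have "f z \<in> {x, z}" using preserves[OF f, of z y] that by auto
    moreover have "f z \<noteq> x" using inj_P[OF f] that z by (metis injD)
    ultimately show ?thesis using z that by auto
  qed
  have "T x \<subseteq> ?A"
  proof (rule tail_class_minimal)
    show "x \<in> ?A" using out assms arc_V by blast
    show "D\<inverse> `` (D `` ?A) \<subseteq> ?A"
    proof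
      fix x'' assume "x'' \<in> D\<inverse> `` (D `` ?A)"
      then obtain x' y' where *: "x' \<in> ?A" "(x', y') \<in> D" "(x'', y') \<in> D" by auto
      then have "f x' = x'" "f y' = y'" by auto
      with * have "f x'' = x''" using "in" by blast
      then show "x'' \<in> ?A" using * \<open>f y' = y'\<close> out arc_V by blast
    qed
  qed
  then show ?thesis using z by blast
qed

end

text \<open>\<open>\<rho>\<close> moves the alternating walk \<open>u, \<rho> v, \<rho> u, \<rho>\<^sup>2 v, \<rho>\<^sup>2 u, \<dots>\<close> by two steps.\<close>

locale rotation_at = half_arc_digraph +
  fixes u v :: 'a and \<rho> :: "'a \<Rightarrow> 'a"
  assumes uv: "(u, v) \<in> D" and rho: "\<rho> \<in> P" "\<rho> v \<noteq> v" "\<rho> u \<noteq> u"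
    and out_u: "D `` {u} = {v, \<rho> v}" and in_rv: "D\<inverse> `` {\<rho> v} = {u, \<rho> u}"
begin

lemma out_power: "D `` {(\<rho> ^^ j) u} = {(\<rho> ^^ j) v, (\<rho> ^^ Suc j) v}"
  using image_out[OF funpow_P[OF rho(1), of j], of "{u}"] out_u by (simp add: funpow_swap1)

lemma in_power: "D\<inverse> `` {(\<rho> ^^ Suc j) v} = {(\<rho> ^^ j) u, (\<rho> ^^ Suc j) u}"
  using half_arc_digraph.image_out[OF dual funpow_P[OF rho(1), of j], of "{\<rho> v}"] in_rv
  by (simp add: funpow_swap1)

lemma rho_order: obtains N where "\<rho> ^^ N = id" "N > 0"
  using permutation_is_nilpotent permutes[OF rho(1)] finite_V unfolding permutation_permutes by metis

lemma in_v: "D\<inverse> `` {v} = {u, inv_into UNIV \<rho> u}"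
proof -
  have "D\<inverse> `` {v} = inv_into UNIV \<rho> ` (D\<inverse> `` {\<rho> v})"
    using half_arc_digraph.image_out[OF dual inv_closed[OF rho(1)], of "{\<rho> v}"] rho by simp
  then show ?thesis using in_rv rho by auto
qed

lemma tail_class_u: "T u = range (\<lambda>j. (\<rho> ^^ j) u)"
proof
  show "range (\<lambda>j. (\<rho> ^^ j) u) \<subseteq> T u"
  proof clarify
    fix j show "(\<rho> ^^ j) u \<in> T u"
    proof (induction j)
      case (Suc j)
      have "((\<rho> ^^ j) u, (\<rho> ^^ Suc j) v) \<in> D" using out_power by blast
      moreover have "((\<rho> ^^ Suc j) u, (\<rho> ^^ Suc j) v) \<in> D" using in_power by blast
      ultimately show ?case using Suc tail_class_closed[of D u] by blast
    qed simp
  qed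
  obtain N where N: "\<rho> ^^ N = id" "N > 0" using rho_order by blast
  have "u \<in> range (\<lambda>j. (\<rho> ^^ j) u)" by (rule range_eqI[of _ _ 0]) simp
  moreover have "D\<inverse> `` (D `` range (\<lambda>j. (\<rho> ^^ j) u)) \<subseteq> range (\<lambda>j. (\<rho> ^^ j) u)"
  proof -
    have S: "D\<inverse> `` {(\<rho> ^^ Suc j) v} \<subseteq> range (\<lambda>j. (\<rho> ^^ j) u)" for j
    proof -
      have "(\<rho> ^^ i) u \<in> range (\<lambda>j. (\<rho> ^^ j) u)" for i by blast
      then show ?thesis unfolding in_power by blast
    qed
    have "D\<inverse> `` {(\<rho> ^^ j) v} \<subseteq> range (\<lambda>j. (\<rho> ^^ j) u)" for j
    proof (cases j)
      case 0
      \<comment> \<open>\<open>in_power\<close> speaks of positive exponents; finite order supplies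
        one for \<open>v\<close> itself.\<close>
      have "(\<rho> ^^ j) v = (\<rho> ^^ Suc (N - 1)) v" using 0 N by simp
      then show ?thesis using S by metis
    qed (use S in blast)
    moreover have "D `` range (\<lambda>j. (\<rho> ^^ j) u) \<subseteq> range (\<lambda>j. (\<rho> ^^ j) v)"
      using out_power by blast
    ultimately show ?thesis by blast
  qed
  ultimately show "T u \<subseteq> range (\<lambda>j. (\<rho> ^^ j) u)" by (rule tail_class_minimal)
qed

lemma out_tail_class_u: "D `` T u = range (\<lambda>j. (\<rho> ^^ j) v)"
proof -
  have "D `` T u = (\<Union>j. D `` {(\<rho> ^^ j) u})" unfolding tail_class_u by blast
  also have "\<dots> = range (\<lambda>j. (\<rho> ^^ j) v)"
    unfolding out_power by (auto intro: range_eqI[of _ _ "Suc _"])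
  finally show ?thesis .
qed

text \<open>The element \<open>?f\<close> fixes \<open>u\<close> and \<open>v\<close>, hence their
  whole alternating cycle. This is the dihedral relation on that cycle, not yet on all of
  \<open>V\<close>.\<close>

lemma reflection_rotation:
  assumes \<tau>: "\<tau> \<in> P" "\<tau> u = u" "\<tau> v = \<rho> v"
  shows "\<tau> (\<rho> v) = v" and "\<tau> (\<rho> u) = inv_into UNIV \<rho> u"
    and "\<And>z. z \<in> T u \<union> D `` T u \<Longrightarrow> \<rho> (\<tau> (\<rho> z)) = \<tau> z"
proof -
  have "\<tau> (\<rho> v) \<in> {v, \<rho> v}" using out_u preserves[OF \<tau>(1), of u "\<rho> v"] \<tau>(2) by auto
  moreover have "\<tau> (\<rho> v) \<noteq> \<rho> v" using \<tau> rho inj_P[OF \<tau>(1)] by (metis injD)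
  ultimately show 1: "\<tau> (\<rho> v) = v" by auto
  have "(\<rho> u, \<rho> v) \<in> D" using in_rv by blast
  then have "\<tau> (\<rho> u) \<in> D\<inverse> `` {v}" using preserves[OF \<tau>(1)] 1 by force
  moreover have "\<tau> (\<rho> u) \<noteq> u" using \<tau> rho inj_P[OF \<tau>(1)] by (metis injD)
  ultimately show 2: "\<tau> (\<rho> u) = inv_into UNIV \<rho> u" using in_v by auto
  let ?f = "inv_into UNIV \<tau> \<circ> \<rho> \<circ> \<tau> \<circ> \<rho>"
  have f: "?f \<in> P" using \<tau> rho comp_closed inv_closed by auto
  have fu: "?f u = u" using 2 \<tau> rho inv_P by (metis comp_apply)
  have fv: "?f v = v" using 1 \<tau> rho inv_P by (metis comp_apply)
  fix z assume "z \<in> T u \<union> D `` T u"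
  then have "?f z = z" by (rule fixes_class[OF f uv fu fv])
  then show "\<rho> (\<tau> (\<rho> z)) = \<tau> z" using \<tau> inv_P by (metis comp_apply)
qed

text \<open>
  If the walk met a vertex both as a tail and as a head, then \<open>v = \<rho>\<^sup>l u\<close> for some \<open>l\<close>, and
  the reflection at \<open>u\<close> would turn this into the arc \<open>(v, u)\<close>.
\<close>

lemma disjoint_u: "T u \<inter> D `` T u = {}"
proof (rule ccontr)
  assume "\<not> ?thesis"
  then obtain j k where jk: "(\<rho> ^^ j) u = (\<rho> ^^ k) v"
    unfolding out_tail_class_u unfolding tail_class_u by blast
  obtain N where N: "\<rho> ^^ N = id" "N > 0" using rho_order by blast
  have "\<rho> ^^ (N * k) = id" using N by (simp add: funpow_mult[symmetric])
  moreover have "N * k = (N * k - k) + k" using N by simp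
  ultimately have "(\<rho> ^^ (N * k - k)) ((\<rho> ^^ k) v) = v" by (metis comp_apply funpow_add id_apply)
  then obtain l where l: "v = (\<rho> ^^ l) u" using jk by (metis comp_apply funpow_add)
  obtain \<tau> where \<tau>: "\<tau> \<in> P" "\<tau> u = u" "\<tau> v \<noteq> v" "D `` {u} = {v, \<tau> v}"
    using reflection[OF uv] by metis
  then have tv: "\<tau> v = \<rho> v" using out_u by auto
  have "(\<rho> ^^ i) (\<tau> ((\<rho> ^^ i) u)) = u" for i
  proof (induction i)
    case (Suc i)
    have "(\<rho> ^^ Suc i) (\<tau> ((\<rho> ^^ Suc i) u)) = (\<rho> ^^ i) (\<rho> (\<tau> (\<rho> ((\<rho> ^^ i) u))))"
      by (simp add: funpow_swap1)
    also have "\<rho> (\<tau> (\<rho> ((\<rho> ^^ i) u))) = \<tau> ((\<rho> ^^ i) u)"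
      by (rule reflection_rotation(3)) (use \<tau> tv tail_class_u in auto)
    finally show ?case using Suc by simp
  qed (use \<tau> in simp)
  \<comment> \<open>The tail \<open>(\<rho> ^^ l) u\<close> is \<open>v\<close>, and its
    out-neighbour \<open>(\<rho> ^^ Suc l) v\<close> turns out to be \<open>u\<close>.\<close>
  from this[of l] have "(\<rho> ^^ Suc l) v = u" using l tv by (simp add: funpow_swap1)
  then have "(v, u) \<in> D" using out_power[of l] l by auto
  then show False using uv asymmetric by blast
qed

text \<open>Tails and heads are \<open>\<rho>\<close>-orbits of equal size, and
  \<open>disjoint_u\<close> keeps even positions apart from odd ones, so the walk closes exactly
  when both orbits are exhausted.\<close>

lemma alternating_sequence_u:
  "alternating_sequence D (\<lambda>i. if even i then (\<rho> ^^ (i div 2)) u else (\<rho> ^^ (Suc (i div 2))) v)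
     (2 * card (T u))"
  (is "alternating_sequence D ?y ?L")
proof -
  let ?n = "card (T u)"
  have perm: "\<rho> permutes V" using permutes rho by blast
  have u: "?n > 0" "(\<rho> ^^ ?n) u = u" "inj_on (\<lambda>j. (\<rho> ^^ j) u) {..<?n}"
    using funpow_orbit[OF perm finite_V, of u] tail_class_u by auto
  have "card (D `` T u) = ?n" using card_out_tail_class uv arc_V by blast
  then have v: "(\<rho> ^^ ?n) v = v" "inj_on (\<lambda>j. (\<rho> ^^ j) v) {..<?n}"
    using funpow_orbit[OF perm finite_V, of v] out_tail_class_u by auto
  have "?n \<noteq> 1"
    using u(2) rho by auto
  with u have n: "?n > 1" by auto
  have "inj_on ?y {..<?L}"
  proof (rule inj_onI)
    fix i j assume ij: "i \<in> {..<?L}" "j \<in> {..<?L}" "?y i = ?y j"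
    have T: "(\<rho> ^^ k) u \<noteq> (\<rho> ^^ l) v" for k l
      using disjoint_u out_tail_class_u tail_class_u by blast
    have lt: "i div 2 < ?n" "j div 2 < ?n" using ij by auto
    show "i = j"
    proof (cases "even i")
      case True
      then have ev: "even j" using ij(3) T[of "i div 2" "Suc (j div 2)"] by (auto split: if_splits)
      then have "i div 2 = j div 2"
        using ij(3) True u(3) lt by (auto dest: inj_onD)
      then show ?thesis using ev True by (metis dvd_mult_div_cancel)
    next
      case False
      then have od: "odd j" using ij(3) T[of "j div 2" "Suc (i div 2)"] by (auto split: if_splits)
      then have "(\<rho> ^^ (i div 2)) v = (\<rho> ^^ (j div 2)) v"
        using ij(3) False inj_P[OF rho(1)] by (auto dest: injD)
      then have "i div 2 = j div 2" using v(2) lt by (auto dest: inj_onD)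
      then show ?thesis using od False by (metis odd_two_times_div_two_succ)
    qed
  qed
  moreover have "?y (i + ?L) = ?y i" for i
  proof -
    have "(\<rho> ^^ (j + ?n)) u = (\<rho> ^^ j) u" "(\<rho> ^^ (j + ?n)) v = (\<rho> ^^ j) v" for j
      using u(2) v(1) by (simp_all add: funpow_add)
    from this[of "i div 2"] show ?thesis by (simp add: add.commute)
  qed
  moreover have "(?y (2 * i), ?y (2 * i + 1)) \<in> D" "(?y (2 * i + 2), ?y (2 * i + 1)) \<in> D" for i
    using out_power[of i] out_power[of "Suc i"] in_power[of i] by auto
  ultimately show ?thesis using n unfolding alternating_sequence_def by auto
qed

end

section \<open>Alternating sequences versus tail classes\<close>

context half_arc_digraph begin

lemma exists_rotation_at:
  assumes "(u, v) \<in> D" obtains \<rho> where "rotation_at V D P u v \<rho>"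
  using rotation[OF assms] assms half_arc_digraph_axioms
  unfolding rotation_at_def rotation_at_axioms_def by metis

lemma disjoint_out_tail_class: assumes "x \<in> V" shows "T x \<inter> D `` T x = {}"
  using assms out_arc exists_rotation_at rotation_at.disjoint_u by metis

lemma exists_alternating_sequence:
  assumes "x \<in> V" obtains y where "alternating_sequence D y (2 * card (T x))" "y 0 = x"
proof -
  obtain v \<rho> where "rotation_at V D P x v \<rho>"
    using assms out_arc exists_rotation_at by metis
  from rotation_at.alternating_sequence_u[OF this] show ?thesis
    by (rule that) simp
qed

text \<open>The two terms next to a given one are distinct, so they are all its out-neighbours or
  all its in-neighbours; hence the sequence exhausts the alternating cycle through
  \<open>y 0\<close>.\<close>

lemma alternating_sequence_class:
  assumes y: "alternating_sequence D y L"
  shows "T (y 0) = range (\<lambda>i. y (2 * i))" (is ?A)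
    and "D `` T (y 0) = range (\<lambda>i. y (2 * i + 1))" (is ?B)
    and "L = 2 * card (T (y 0))" (is ?C)
    and "D \<inter> T (y 0) \<times> UNIV =
      range (\<lambda>i. (y (2 * i), y (2 * i + 1))) \<union> range (\<lambda>i. (y (2 * i + 2), y (2 * i + 1)))" (is ?D)
proof -
  obtain k where L: "L = 2 * k" "k > 1"
    using y by (auto simp: alternating_sequence_def)
  have per: "y (i + 2 * k) = y i" for i
    using y L by (simp add: alternating_sequence_def)
  have inj: "inj_on y {..<2 * k}" using y L by (simp add: alternating_sequence_def)
  have D: "(y (2 * i), y (2 * i + 1)) \<in> D" "(y (2 * i + 2), y (2 * i + 1)) \<in> D" for i
    using y by (simp_all add: alternating_sequence_def)
  have per': "y (i + 2 * k * j) = y i" for i j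
    by (induction j) (simp, metis add.assoc add.commute mult_Suc_right per)
  have ymod: "y i = y (i mod (2 * k))" for i
    using per'[of "i mod (2 * k)" "i div (2 * k)"] by simp
  \<comment> \<open>Here \<open>k > 1\<close> matters: a sequence of period two would go back and
    forth along one arc.\<close>
  have neq: "y (i + 2) \<noteq> y i" for i
  proof
    assume "y (i + 2) = y i"
    then have "(i + 2) mod (2 * k) = i mod (2 * k)"
      using inj L ymod[of i] ymod[of "i + 2"] by (auto dest: inj_onD)
    then have "2 * k dvd 2" by (metis add_diff_cancel_left' le_add1 mod_eq_dvd_iff_nat)
    then show False using L by auto
  qed
  have out: "D `` {y (2 * i + 2)} = {y (2 * i + 1), y (2 * i + 3)}" for i
    by (rule out_pair) (use D[of i] D[of "i + 1"] neq[of "2 * i + 1"] in \<open>auto simp: numeral_eq_Suc\<close>)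
  \<comment> \<open>The head before index \<open>2 * i\<close> is taken one period later, which
    avoids a negative index at \<open>i = 0\<close>.\<close>
  have out': "D `` {y (2 * i)} = {y (2 * (i + k - 1) + 1), y (2 * i + 1)}" for i
  proof -
    have "2 * (i + k - 1) + 2 = 2 * i + 2 * k" "2 * (i + k - 1) + 3 = (2 * i + 1) + 2 * k"
      using L by auto
    then show ?thesis using out[of "i + k - 1"] per by metis
  qed
  have "in": "D\<inverse> `` {y (2 * i + 1)} = {y (2 * i), y (2 * i + 2)}" for i
    by (rule in_pair) (use D[of i] neq[of "2 * i"] in auto)
  show A: ?A
  proof
    show "T (y 0) \<subseteq> range (\<lambda>i. y (2 * i))"
    proof (rule tail_class_minimal)
      show "y 0 \<in> range (\<lambda>i. y (2 * i))" by (rule range_eqI[of _ _ 0]) simp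
      have "D `` range (\<lambda>i. y (2 * i)) \<subseteq> range (\<lambda>i. y (2 * i + 1))"
      proof -
        have "D `` {y (2 * i)} \<subseteq> range (\<lambda>i. y (2 * i + 1))" for i
          unfolding out'[of i] by blast
        then show ?thesis by blast
      qed
      moreover have "D\<inverse> `` range (\<lambda>i. y (2 * i + 1)) \<subseteq> range (\<lambda>i. y (2 * i))"
      proof -
        have "D\<inverse> `` {y (2 * i + 1)} \<subseteq> range (\<lambda>i. y (2 * i))" for i
          unfolding "in" by (auto intro: range_eqI[of _ _ "Suc i"])
        then show ?thesis by blast
      qed
      ultimately show "D\<inverse> `` (D `` range (\<lambda>i. y (2 * i))) \<subseteq> range (\<lambda>i. y (2 * i))" by blast
    qed
    show "range (\<lambda>i. y (2 * i)) \<subseteq> T (y 0)"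
    proof clarify
      fix i show "y (2 * i) \<in> T (y 0)"
      proof (induction i)
        case (Suc i)
        then have "y (2 * i + 2) \<in> T (y 0)"
          using D[of i] tail_class_closed[of D "y 0"] by blast
        then show ?case by simp
      qed simp
    qed
  qed
  show ?B unfolding A
  proof
    have "D `` {y (2 * i)} \<subseteq> range (\<lambda>i. y (2 * i + 1))" for i
      unfolding out'[of i] by blast
    then show "D `` range (\<lambda>i. y (2 * i)) \<subseteq> range (\<lambda>i. y (2 * i + 1))" by blast
    have "y (2 * i + 1) \<in> D `` range (\<lambda>i. y (2 * i))" for i
      by (rule ImageI[OF D(1)]) (rule rangeI)
    then show "range (\<lambda>i. y (2 * i + 1)) \<subseteq> D `` range (\<lambda>i. y (2 * i))" by (rule image_subsetI)
  qed
  have "range (\<lambda>i. y (2 * i)) = (\<lambda>i. y (2 * i)) ` {..<k}"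
  proof -
    have "y (2 * i) = y (2 * (i mod k))" for i
      unfolding mult_mod_right by (rule ymod)
    moreover have "i mod k \<in> {..<k}" for i using L by auto
    ultimately have "range (\<lambda>i. y (2 * i)) \<subseteq> (\<lambda>i. y (2 * i)) ` {..<k}"
    proof (intro image_subsetI)
      fix i show "y (2 * i) \<in> (\<lambda>i. y (2 * i)) ` {..<k}"
        by (rule image_eqI[of _ _ "i mod k"]) fact+
    qed
    then show ?thesis by auto
  qed
  moreover have "inj_on (\<lambda>i. y (2 * i)) {..<k}"
    by (rule inj_onI) (use inj_onD[OF inj] in fastforce)
  ultimately show ?C using A L by (simp add: card_image)
  show ?D
  proof (intro subset_antisym subrelI)
    fix a b assume "(a, b) \<in> D \<inter> T (y 0) \<times> UNIV"
    then obtain i where i: "a = y (2 * i)" "b \<in> D `` {y (2 * i)}" using A by auto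
    have "2 * (i + k - 1) + 2 = 2 * i + 2 * k" using L by auto
    then have "y (2 * i) = y (2 * (i + k - 1) + 2)"
      using per[of "2 * i"] by metis
    then have "(a, b) = (y (2 * (i + k - 1) + 2), y (2 * (i + k - 1) + 1)) \<or>
        (a, b) = (y (2 * i), y (2 * i + 1))"
      using i(1) i(2)[unfolded out'[of i]] by auto
    then show "(a, b) \<in> range (\<lambda>i. (y (2 * i), y (2 * i + 1))) \<union>
        range (\<lambda>i. (y (2 * i + 2), y (2 * i + 1)))"
      by (metis (no_types, lifting) UnCI rangeI)
  next
    fix a b assume "(a, b) \<in> range (\<lambda>i. (y (2 * i), y (2 * i + 1))) \<union>
        range (\<lambda>i. (y (2 * i + 2), y (2 * i + 1)))"
    moreover have "y (2 * i + 2) \<in> T (y 0)" for i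
      unfolding A by (rule range_eqI[of _ _ "Suc i"]) simp
    ultimately show "(a, b) \<in> D \<inter> T (y 0) \<times> UNIV" using D A by auto
  qed
qed

end

section \<open>Tight attachment\<close>

context half_arc_digraph begin

text \<open>\<open>S1\<close> and \<open>S2\<close> split the vertices common to the two alternating
  cycles through \<open>x\<close>. Once no arc runs from \<open>S1\<close> to \<open>S2\<close>, the
  arcs leaving \<open>S1\<close> and those entering \<open>S2\<close> exhaust the arcs leaving
  \<open>T x\<close>; this spreads \<open>S1\<close> over all of \<open>T x\<close> and leaves
  \<open>S2\<close> empty.\<close>

lemma tightly_attached_classes:
  assumes x: "x \<in> V"
    and tight: "card ((T x \<union> D `` T x) \<inter> (H x \<union> D\<inverse> `` H x)) = card (T x)"
  shows "T x = H x" and "D `` T x \<inter> D\<inverse> `` T x = {}"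
proof -
  interpret dual: half_arc_digraph V "D\<inverse>" P by (rule dual)
  define S1 where "S1 = T x \<inter> H x"
  define S2 where "S2 = D `` T x \<inter> D\<inverse> `` H x"
  obtain y where y: "(x, y) \<in> D" using out_arc x by blast
  obtain w where w: "(w, x) \<in> D" using dual.out_arc[OF x] by auto
  have O: "D `` T x = H y" using out_tail_class[OF y] .
  have I: "D\<inverse> `` H x = T w" using out_tail_class[of x w "D\<inverse>"] w by simp
  have wx: "D `` T w = H x" using out_tail_class[OF w] .
  have yx: "D\<inverse> `` H y = T x" using out_tail_class[of y x "D\<inverse>"] y by simp
  have TO: "T x \<inter> D `` T x = {}" using disjoint_out_tail_class[OF x] .
  have HI: "H x \<inter> D\<inverse> `` H x = {}" using dual.disjoint_out_tail_class[OF x] by simp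
  \<comment> \<open>A common vertex would make \<open>T x\<close> equal to \<open>T w\<close>, and
    \<open>x\<close> would be a tail of the very cycle on which it is a head.\<close>
  have TI: "T x \<inter> D\<inverse> `` H x = {}"
    using HI tail_class_disjoint[of _ D x w] I tail_class_self[of x D] tail_class_self[of x "D\<inverse>"]
    by blast
  have OH: "D `` T x \<inter> H x = {}"
    using TO tail_class_disjoint[of _ "D\<inverse>" y x] O tail_class_self[of x D] tail_class_self[of x "D\<inverse>"]
    by blast
  have TV: "T x \<subseteq> V" using tail_class_V[OF x] .
  have S2V: "S2 \<subseteq> V" using D_subset by (auto simp: S2_def)
  have S1V: "S1 \<subseteq> V" using TV by (auto simp: S1_def)
  have fin: "finite S1" "finite S2" using S1V S2V finite_V finite_subset by auto
  have "(T x \<union> D `` T x) \<inter> (H x \<union> D\<inverse> `` H x) = S1 \<union> S2" "S1 \<inter> S2 = {}"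
    using TI OH TO by (auto simp: S1_def S2_def)
  with tight fin have card: "card S1 + card S2 = card (T x)"
    by (simp add: card_Un_disjoint)
  have S1: "T a = T x" "H a = H x" if "a \<in> S1" for a
    using that tail_class_eq[of a D x] tail_class_eq[of a "D\<inverse>" x] by (auto simp: S1_def)
  have S2: "H b = H y" "T b = T w" if "b \<in> S2" for b
    using that tail_class_eq[of b D w] tail_class_eq[of b "D\<inverse>" y] O I by (auto simp: S2_def)
  \<comment> \<open>The reflection at a vertex of \<open>S1 \<union> S2\<close> preserves \<open>S1\<close> and \<open>S2\<close>, so a single arc from
      \<open>S1\<close> to \<open>S2\<close> would force the whole alternating cycle into \<open>S1 \<union> S2\<close>.\<close>
  have no_arc: "b \<notin> S2" if a: "a \<in> S1" and ab: "(a, b) \<in> D" for a b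
  proof
    assume b: "b \<in> S2"
    have out: "D `` {a} \<subseteq> S2" if a: "a \<in> S1" "(a, b) \<in> D" "b \<in> S2" for a b
    proof -
      obtain \<tau> where \<tau>: "\<tau> \<in> P" "\<tau> a = a" "D `` {a} = {b, \<tau> b}"
        using reflection[OF a(2)] by metis
      have "\<tau> ` T x = T x" "\<tau> ` H x = H x"
        using tail_class_image[OF \<tau>(1), of a] dual.tail_class_image[OF \<tau>(1), of a] \<tau> S1[OF a(1)]
        by simp_all
      then have "\<tau> ` (D `` T x) = D `` T x" "\<tau> ` (D\<inverse> `` H x) = D\<inverse> `` H x"
        using image_out[OF \<tau>(1)] dual.image_out[OF \<tau>(1)] by metis+
      then have "\<tau> b \<in> S2"
        using a(3) unfolding S2_def by (metis IntD1 IntD2 IntI imageI)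
      then show ?thesis using \<tau> a by auto
    qed
    have "in": "D\<inverse> `` {b} \<subseteq> S1" if a: "a \<in> S1" "(a, b) \<in> D" "b \<in> S2" for a b
    proof -
      obtain \<tau> where \<tau>: "\<tau> \<in> P" "\<tau> b = b" "D\<inverse> `` {b} = {a, \<tau> a}"
        using dual.reflection[of b a] a(2) by auto
      have "\<tau> ` H y = H y" "\<tau> ` T w = T w"
        using tail_class_image[OF \<tau>(1), of b] dual.tail_class_image[OF \<tau>(1), of b] \<tau> S2[OF a(3)]
        by simp_all
      then have "\<tau> ` T x = T x" "\<tau> ` H x = H x"
        using image_out[OF \<tau>(1)] dual.image_out[OF \<tau>(1)] wx yx by metis+
      then have "\<tau> a \<in> S1"
        using a(1) unfolding S1_def by (metis IntD1 IntD2 IntI imageI)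
      then show ?thesis using \<tau> a by auto
    qed
    have "T a \<subseteq> {t \<in> S1. D `` {t} \<subseteq> S2}"
    proof (rule tail_class_minimal)
      show "a \<in> {t \<in> S1. D `` {t} \<subseteq> S2}" using out a ab b by blast
      show "D\<inverse> `` (D `` {t \<in> S1. D `` {t} \<subseteq> S2}) \<subseteq> {t \<in> S1. D `` {t} \<subseteq> S2}"
      proof
        fix t' assume "t' \<in> D\<inverse> `` (D `` {t \<in> S1. D `` {t} \<subseteq> S2})"
        then obtain t c where t: "t \<in> S1" "(t, c) \<in> D" "(t', c) \<in> D" "c \<in> S2" by auto
        then have "t' \<in> S1" using "in" by blast
        then show "t' \<in> {t \<in> S1. D `` {t} \<subseteq> S2}" using out t by blast
      qed
    qed
    then have "card (T x) \<le> card S1" using S1[OF a] fin by (intro card_mono) auto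
    moreover have "card S2 > 0" using b fin by (auto simp: card_gt_0_iff)
    ultimately show False using card by simp
  qed
  have into: "D \<inter> UNIV \<times> S2 \<subseteq> D \<inter> T x \<times> UNIV"
    using tail_class_closed[of D x] by (auto simp: S2_def)
  \<comment> \<open>The two disjoint families have \<open>2 * card S1 + 2 * card S2\<close> arcs,
    which by tightness is the number of all arcs leaving \<open>T x\<close>.\<close>
  have "(D \<inter> S1 \<times> UNIV) \<union> (D \<inter> UNIV \<times> S2) = D \<inter> T x \<times> UNIV"
  proof (rule card_seteq)
    show "finite (D \<inter> T x \<times> UNIV)" using finite_D by simp
    show "(D \<inter> S1 \<times> UNIV) \<union> (D \<inter> UNIV \<times> S2) \<subseteq> D \<inter> T x \<times> UNIV"
      using into by (auto simp: S1_def)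
    have "(D \<inter> S1 \<times> UNIV) \<inter> (D \<inter> UNIV \<times> S2) = {}" using no_arc by auto
    then have "card ((D \<inter> S1 \<times> UNIV) \<union> (D \<inter> UNIV \<times> S2)) = 2 * card S1 + 2 * card S2"
      using finite_D card_arcs_from[OF S1V] card_arcs_into[OF S2V] by (simp add: card_Un_disjoint)
    then show "card (D \<inter> T x \<times> UNIV) \<le> card ((D \<inter> S1 \<times> UNIV) \<union> (D \<inter> UNIV \<times> S2))"
      using card card_arcs_from[OF TV] by simp
  qed
  then have either: "a \<in> S1 \<or> b \<in> S2" if "a \<in> T x" "(a, b) \<in> D" for a b
    using that by blast
  have "T x \<subseteq> S1"
  proof (rule tail_class_minimal)
    show "x \<in> S1" by (simp add: S1_def)
    show "D\<inverse> `` (D `` S1) \<subseteq> S1"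
    proof
      fix t' assume "t' \<in> D\<inverse> `` (D `` S1)"
      then obtain t c where t: "t \<in> S1" "(t, c) \<in> D" "(t', c) \<in> D" by auto
      then have "t' \<in> T x" using tail_class_closed[of D x] by (auto simp: S1_def)
      then show "t' \<in> S1" using either t no_arc by blast
    qed
  qed
  then have S1_eq: "S1 = T x" by (auto simp: S1_def)
  have "card (H x) = card (T x)"
    using card_out_tail_class[of w] wx card_tail_class[of w x] w arc_V x by metis
  then show TH: "T x = H x"
    using S1_eq by (intro card_seteq) (auto simp: S1_def dual.finite_tail_class[OF x])
  have "S2 = {}" using card S1_eq fin by simp
  then show "D `` T x \<inter> D\<inverse> `` T x = {}" using TH by (simp add: S2_def)
qed

end

section \<open>Coordinates\<close>

text \<open>\<open>n\<close> is the radius. By \<open>T_eq_H\<close> the heads of one alternating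
  cycle are the tails of the next; \<open>out_in_disjoint\<close> keeps the blocks before and after
  a given one apart, which later rules out \<open>m = 2\<close>.\<close>

locale tight_digraph = half_arc_digraph +
  fixes n :: nat
  assumes n_ge: "n \<ge> 4" and n_even: "even n" and card_T: "x \<in> V \<Longrightarrow> card (T x) = n"
    and T_eq_H: "x \<in> V \<Longrightarrow> T x = H x"
    and out_in_disjoint: "x \<in> V \<Longrightarrow> D `` T x \<inter> D\<inverse> `` T x = {}"
begin

text \<open>
  Fixing an arc forces fixing its alternating cycle, and, as the heads of this cycle are the tails
  of the next one and there are more than two of them, also the next cycle.
\<close>

lemma fixes_arc:
  assumes f: "f \<in> P" and arc: "(x, y) \<in> D" "f x = x" "f y = y"
  shows "f = id"
proof -
  let ?S = "{x \<in> V. f x = x \<and> (\<forall>y\<in>D `` {x}. f y = y)}"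
  have step: "f z = z" if xy: "(x, y) \<in> D" "f x = x" "f y = y" and yz: "(y, z) \<in> D" for x y z
  proof (rule ccontr)
    assume neq: "f z \<noteq> z"
    have "T y = D `` T x" using out_tail_class[OF xy(1)] T_eq_H arc_V[OF xy(1)] by simp
    then have fix_T: "f a = a" if "a \<in> T y" for a
      using fixes_class[OF f xy] that by blast
    obtain y' where y': "y' \<noteq> y" "D\<inverse> `` {z} = {y, y'}" using other_in[OF yz] by blast
    have "D\<inverse> `` {z} \<subseteq> T y" using tail_class_closed[of D y] yz tail_class_self[of y D] by blast
    then have fy: "f y = y" "f y' = y'" using fix_T y' by auto
    have fz: "(y, f z) \<in> D" "(y', f z) \<in> D"
      using preserves[OF f, of y z] preserves[OF f, of y' z] fy y' yz by auto
    have "D `` {y} = {z, f z}" "D `` {y'} = {z, f z}" "D\<inverse> `` {f z} = {y, y'}"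
      using out_pair[OF yz fz(1)] out_pair[of y' z "f z"] in_pair[OF fz] y' fz neq by auto
    \<comment> \<open>\<open>y\<close> and \<open>y'\<close> share both out-neighbours, so their
      alternating cycle would have only two tails.\<close>
    then have "D\<inverse> `` (D `` {y, y'}) \<subseteq> {y, y'}" using y' by (auto simp: Image_iff)
    then have "T y \<subseteq> {y, y'}" by (intro tail_class_minimal) auto
    then have "card (T y) \<le> 2" using y' card_mono[of "{y, y'}" "T y"] by simp
    then show False using n_ge card_T arc_V[OF yz] by simp
  qed
  have "?S = V"
  proof (rule connected_forward)
    show "?S \<subseteq> V" by auto
    have "\<forall>z\<in>D `` {x}. f z = z"
    proof
      fix z assume "z \<in> D `` {x}"
      then have "z \<in> D `` T x" using tail_class_self[of x D] by blast
      then show "f z = z" using fixes_class[OF f arc] by blast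
    qed
    then show "?S \<noteq> {}" using arc arc_V by blast
    show "D `` ?S \<subseteq> ?S"
    proof
      fix y assume "y \<in> D `` ?S"
      then obtain x where "x \<in> ?S" "(x, y) \<in> D" by auto
      then show "y \<in> ?S" using step arc_V by blast
    qed
  qed
  then have "f x = x" if "x \<in> V" for x using that by blast
  moreover have "f x = x" if "x \<notin> V" for x
    using permutes[OF f] that by (rule permutes_not_in)
  ultimately show ?thesis by (metis eq_id_iff)
qed

text \<open>Arc stabilizers are trivial, so equality of two elements of \<open>P\<close> can be
  tested on a single arc.\<close>

lemma agree_on_arc:
  assumes "f \<in> P" "g \<in> P" "(x, y) \<in> D" "f x = g x" "f y = g y"
  shows "f = g"
proof -
  have "inv_into UNIV g \<circ> f = id"
    by (rule fixes_arc[OF _ assms(3)]) (use assms in \<open>auto simp: comp_closed inv_closed\<close>)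
  then show ?thesis using assms(2) by (metis comp_apply ext id_apply inv_P(2))
qed

end

text \<open>The shift \<open>\<sigma>\<close> to the next block is determined only up to composition
  with \<open>\<tau>\<close> on the right; either choice serves.\<close>

locale framed_digraph = tight_digraph V D P n + rotation_at V D P u v \<rho>
  for V :: "'a set" and D P n u v \<rho> +
  fixes \<sigma> \<tau> :: "'a \<Rightarrow> 'a"
  assumes sigma: "\<sigma> \<in> P" "\<sigma> u = v" and tau: "\<tau> \<in> P" "\<tau> u = u" "\<tau> v = \<rho> v"
begin

text \<open>Powers of \<open>\<rho>\<close> with exponents read modulo \<open>n\<close>, as negative
  exponents and multiples by powers of \<open>r\<close> occur.\<close>

definition R :: "int \<Rightarrow> 'a \<Rightarrow> 'a" where "R j = \<rho> ^^ nat (j mod int n)"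

lemma u_V: "u \<in> V" and v_V: "v \<in> V"
  using uv arc_V by auto

text \<open>The orbits of \<open>u\<close> and \<open>v\<close> both have size \<open>n\<close>, so
  this power fixes an arc.\<close>

lemma rho_n: "\<rho> ^^ n = id"
proof (rule fixes_arc[OF _ uv])
  show "\<rho> ^^ n \<in> P" using funpow_P rho by blast
  have perm: "\<rho> permutes V" using permutes rho by blast
  show "(\<rho> ^^ n) u = u"
    using funpow_orbit(2)[OF perm finite_V, of u] tail_class_u card_T[OF u_V] by simp
  show "(\<rho> ^^ n) v = v"
    using funpow_orbit(2)[OF perm finite_V, of v] out_tail_class_u card_out_tail_class[OF u_V]
      card_T[OF u_V] by simp
qed

lemma R_cong: "[a = b] (mod int n) \<Longrightarrow> R a = R b"
  by (simp add: R_def cong_def)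

lemma funpow_rho: "\<rho> ^^ k = R (int k)"
proof
  fix x
  have "(\<rho> ^^ (k mod n)) x = (\<rho> ^^ k) x"
    by (rule funpow_mod_eq) (simp add: rho_n)
  then show "(\<rho> ^^ k) x = R (int k) x"
    by (simp add: R_def nat_mod_as_int)
qed

lemma R_R: "R a (R b x) = R (a + b) x"
proof -
  have "R a (R b x) = (\<rho> ^^ (nat (a mod int n) + nat (b mod int n))) x"
    by (simp add: R_def funpow_add)
  also have "\<dots> = R (a mod int n + b mod int n) x"
    using n_ge by (simp add: funpow_rho)
  also have "\<dots> = R (a + b) x"
    by (rule fun_cong[OF R_cong]) (simp add: cong_def mod_simps)
  finally show ?thesis .
qed

lemma R_0 [simp]: "R 0 x = x"
  by (simp add: R_def)

lemma R_1: "\<rho> x = R 1 x"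
  using fun_cong[OF funpow_rho[of 1], of x] by simp

lemma R_P: "R a \<in> P"
  by (simp add: R_def funpow_P rho)

lemma R_u_eq_iff: "R a u = R b u \<longleftrightarrow> [a = b] (mod int n)"
proof
  assume *: "R a u = R b u"
  have "\<rho> permutes V" using permutes rho by blast
  from funpow_orbit(3)[OF this finite_V, of u] have "inj_on (\<lambda>j. (\<rho> ^^ j) u) {..<n}"
    using tail_class_u card_T[OF u_V] by simp
  moreover have "nat (c mod int n) < n" for c using n_ge by (simp add: nat_less_iff)
  ultimately have "nat (a mod int n) = nat (b mod int n)"
    using * by (auto simp: R_def dest!: inj_onD)
  then show "[a = b] (mod int n)" using n_ge by (simp add: cong_def nat_eq_iff)
qed (use R_cong in metis)

lemma T_u: "T u = range (\<lambda>j. R j u)"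
proof -
  have "T u \<subseteq> range (\<lambda>j. R j u)" unfolding tail_class_u funpow_rho by auto
  moreover have "R j u \<in> T u" for j unfolding tail_class_u R_def by auto
  ultimately show ?thesis by auto
qed

text \<open>Passes from one step of a commutation relation to all powers; applied with
  \<open>c = -1\<close> for reflections and \<open>c = r\<close> for
  \<open>\<sigma>\<close>.\<close>

lemma intertwine:
  assumes "\<And>x. f (\<rho> x) = R c (f x)"
  shows "f (R j x) = R (c * j) (f x)"
proof -
  have nat: "f ((\<rho> ^^ k) x) = R (c * int k) (f x)" for k
    by (induction k) (simp_all add: assms R_R algebra_simps)
  show ?thesis unfolding R_def[of j] nat
    by (rule fun_cong[OF R_cong]) (use n_ge in \<open>simp add: cong_def mod_simps\<close>)
qed

lemma inv_rho: "inv_into UNIV \<rho> x = R (-1) x"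
  using inv_P(1)[OF rho(1), of "R (-1) x"] by (simp add: R_1 R_R)

lemma not_cong:
  assumes "0 < \<bar>a - b\<bar>" "\<bar>a - b\<bar> < int n" shows "\<not> [a = b] (mod int n)"
  using assms zdvd_imp_le[of "int n" "\<bar>a - b\<bar>"] by (auto simp: cong_iff_dvd_diff)

text \<open>Elements of \<open>P\<close> are determined on an arc, so the dihedral relation extends
  from the alternating cycle to all points.\<close>

lemma tau_R: "\<tau> (R j x) = R (- j) (\<tau> x)"
proof -
  have "\<rho> \<circ> \<tau> \<circ> \<rho> = \<tau>"
  proof (rule agree_on_arc[OF _ tau(1) uv])
    show "\<rho> \<circ> \<tau> \<circ> \<rho> \<in> P" using rho tau comp_closed by blast
    have "v \<in> D `` T u" using uv tail_class_self[of u D] by blast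
    then show "(\<rho> \<circ> \<tau> \<circ> \<rho>) u = \<tau> u" "(\<rho> \<circ> \<tau> \<circ> \<rho>) v = \<tau> v"
      using reflection_rotation(3)[OF tau] by auto
  qed
  then have "R 1 (\<tau> (\<rho> x)) = \<tau> x" for x by (metis R_1 comp_apply)
  then have "\<tau> (\<rho> x) = R (-1) (\<tau> x)" for x
    using R_R[of "-1" 1 "\<tau> (\<rho> x)"] by simp
  from intertwine[of \<tau>, OF this] show ?thesis by simp
qed

lemma stabilizer:
  assumes h: "h \<in> P" "h u = u" shows "h = id \<or> h = \<tau>"
proof -
  have "h v \<in> {v, \<rho> v}" using preserves[OF h(1) uv] h(2) out_u by auto
  then show ?thesis
    using fixes_arc[OF h(1) uv h(2)] agree_on_arc[OF h(1) tau(1) uv] h tau by auto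
qed

text \<open>The quotient of \<open>f\<close> and \<open>g\<close> fixes \<open>u\<close>, so if
  nontrivial it is \<open>\<tau>\<close>; but \<open>\<tau>\<close> takes \<open>R 1 u\<close> to
  \<open>R (-1) u\<close>, a different vertex as \<open>n > 2\<close>.\<close>

lemma agree_on_tails:
  assumes "f \<in> P" "g \<in> P" "f u = g u" "f (R 1 u) = g (R 1 u)"
  shows "f = g"
proof -
  let ?h = "inv_into UNIV g \<circ> f"
  have h: "?h \<in> P" "?h u = u" "?h (R 1 u) = R 1 u"
    using assms by (auto simp: comp_closed inv_closed)
  have "?h \<noteq> \<tau>"
  proof
    assume "?h = \<tau>"
    then have "R (-1) u = R 1 u" using h(3) tau_R[of 1 u] tau by simp
    then have "[-1 = 1] (mod int n)" unfolding R_u_eq_iff .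
    then show False using not_cong[of "-1" 1] n_ge by simp
  qed
  then have "?h = id" using stabilizer[OF h(1,2)] by blast
  then show ?thesis using assms(2) by (metis comp_apply ext id_apply inv_P(2))
qed

text \<open>
  Since \<open>\<sigma>\<close> maps the tails of the alternating cycle to its heads, \<open>\<sigma> \<rho> \<sigma>\<inverse>\<close> agrees with a power
  of \<open>\<rho>\<close> at \<open>v\<close>. If it were not that power, it would act as a reflection, that is, as an involution.
\<close>

lemma sigma_normalizes: "\<exists>r\<in>{0..<int n}. \<forall>x. \<sigma> (\<rho> x) = R r (\<sigma> x)"
proof -
  have "\<sigma> (\<rho> u) \<in> \<sigma> ` T u" using T_u R_1 by auto
  also have "\<dots> = D `` T u"
    using tail_class_image[OF sigma(1), of u] sigma T_eq_H[OF v_V] out_tail_class[OF uv] by simp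
  finally obtain k where "\<sigma> (\<rho> u) = R (int k) v"
    unfolding out_tail_class_u funpow_rho by auto
  then obtain r where r: "r \<in> {0..<int n}" "\<sigma> (\<rho> u) = R r v"
    using R_cong[of "int k mod int n" "int k"] n_ge by (metis atLeastLessThan_iff cong_mod_left
      cong_refl le_trans of_nat_0_less_iff pos_mod_bound pos_mod_sign zero_less_numeral order_less_le_trans)
  define \<sigma>' where "\<sigma>' = inv_into UNIV \<sigma>"
  \<comment> \<open>The conjugate \<open>\<sigma> \<rho> \<sigma>\<inverse>\<close>, corrected by a
    power of \<open>\<rho>\<close> so as to fix \<open>v\<close>; the claim amounts to its
    triviality.\<close>
  define g where "g = R (- r) \<circ> \<sigma> \<circ> \<rho> \<circ> \<sigma>'"
  have s': "\<sigma>' \<in> P" "\<sigma>' (\<sigma> x) = x" "\<sigma> (\<sigma>' x) = x" for x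
    using sigma inv_closed by (auto simp: \<sigma>'_def)
  have g: "g \<in> P" unfolding g_def using R_P sigma rho s' comp_closed by blast
  have gv: "g v = v"
  proof -
    have "\<sigma>' v = u" using s'(2)[of u] sigma by simp
    then show ?thesis using r by (simp add: g_def R_R)
  qed
  have g_sigma: "R r (g (\<sigma> x)) = \<sigma> (\<rho> x)" for x
    by (simp add: g_def s' R_R)
  have "g = id"
  proof (rule ccontr)
    assume neq: "g \<noteq> id"
    have in_v': "D\<inverse> `` {v} = {u, R (-1) u}" using in_v inv_rho by simp
    \<comment> \<open>A nontrivial element fixing \<open>v\<close> must move \<open>u\<close> to the
      other in-neighbour of \<open>v\<close>, as a reflection at \<open>v\<close> does.\<close>
    have gu: "g u = R (-1) u"
      using preserves[OF g uv] gv in_v' fixes_arc[OF g uv _ gv] neq by auto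
    have arc: "(R (-1) u, v) \<in> D" using in_v' by blast
    have out: "D `` {R (-1) u} = {R (-1) v, v}"
      using image_out[OF R_P[of "-1"], of "{u}"] out_u by (simp add: R_1 R_R)
    have ne: "R (-1) u \<noteq> u" using R_u_eq_iff[of "-1" 0] not_cong[of "-1" 0] n_ge by simp
    have "g (R (-1) u) \<noteq> g u" using ne inj_P[OF g] by (metis injD)
    moreover have "g (R (-1) u) \<in> {u, R (-1) u}" using preserves[OF g arc] gv in_v' by auto
    ultimately have gu': "g (R (-1) u) = u" using gu by auto
    have gg: "g \<circ> g = id"
      by (rule fixes_arc[OF _ uv]) (use g gu gu' gv comp_closed in auto)
    have "(u, \<rho> v) \<in> D" using out_u by blast
    then have "g (\<rho> v) \<in> D `` {R (-1) u}" using preserves[OF g, of u "\<rho> v"] gu by auto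
    moreover have "g (\<rho> v) \<noteq> g v" using rho inj_P[OF g] by (metis injD)
    ultimately have gv': "g (\<rho> v) = R (-1) v" using out gv by auto
    have "\<rho> \<circ> g \<circ> \<rho> = g"
      by (rule agree_on_arc[OF _ g arc])
        (use g rho comp_closed gu gu' gv gv' in \<open>auto simp: R_1 R_R\<close>)
    then have "R 1 (g (\<rho> x)) = g x" for x by (metis R_1 comp_apply)
    then have "g (\<rho> x) = R (-1) (g x)" for x
      using R_R[of "-1" 1 "g (\<rho> x)"] by simp
    then have gR: "g (R j x) = R (- j) (g x)" for j x using intertwine[of g "-1"] by simp
    \<comment> \<open>As \<open>g\<close> inverts \<open>\<rho>\<close>, the conjugate
      \<open>R r \<circ> g\<close> is an involution; then \<open>\<rho>\<close> applied twice would
      fix \<open>u\<close>, against \<open>n \<ge> 4\<close>.\<close>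
    have "\<sigma> (\<rho> (\<rho> u)) = R r (g (R r (g (\<sigma> u))))" by (simp only: g_sigma)
    also have "\<dots> = g (g (\<sigma> u))" by (simp add: gR R_R)
    also have "\<dots> = \<sigma> u" using gg by (metis comp_apply id_apply)
    finally have "\<rho> (\<rho> u) = u" using inj_P[OF sigma(1)] by (metis injD)
    then have "R 2 u = R 0 u" by (simp add: R_1 R_R)
    then have "[2 = 0] (mod int n)" unfolding R_u_eq_iff .
    then show False using not_cong[of 2 0] n_ge by simp
  qed
  then have "\<sigma> (\<rho> x) = R r (\<sigma> x)" for x using g_sigma[of x] by simp
  then show ?thesis using r by blast
qed

end

section \<open>Coordinates of the vertices and relations among the parameters\<close>

locale coordinatized_digraph = framed_digraph +
  fixes r :: int
  assumes r_range: "r \<in> {0..<int n}" and sigma_rho: "\<sigma> (\<rho> x) = R r (\<sigma> x)"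
begin

lemma sigma_R: "(\<sigma> ^^ i) (R j x) = R (r ^ i * j) ((\<sigma> ^^ i) x)"
  by (induction i) (simp_all add: intertwine[of \<sigma>, OF sigma_rho] mult.assoc)

lemma sigma_P: "\<sigma> ^^ i \<in> P"
  using funpow_P sigma by blast

lemma sigma_order: obtains N where "\<sigma> ^^ N = id" "N > 0"
  using permutation_is_nilpotent permutes[OF sigma(1)] finite_V unfolding permutation_permutes
  by metis

text \<open>Finite order of \<open>\<sigma>\<close> makes some positive power of \<open>r\<close>
  congruent to \<open>1\<close>.\<close>

lemma coprime_r: "coprime r (int n)"
proof -
  obtain N where N: "\<sigma> ^^ N = id" "N > 0" using sigma_order by blast
  then have "R 1 u = R (r ^ N) u" using sigma_R[of N 1 u] by simp
  then have "[1 = r ^ N] (mod int n)" unfolding R_u_eq_iff .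
  then have "coprime (r ^ N) (int n)" using cong_imp_coprime[of 1 "r ^ N" "int n"] by simp
  then show ?thesis using N by simp
qed

lemma odd_r: "odd r"
  using coprime_r n_even coprime_common_divisor[of r "int n" 2] by auto

text \<open>\<open>r\<close> is a unit modulo \<open>n\<close>, so a power of \<open>\<rho>\<close>
  can be moved past \<open>\<sigma> ^^ i\<close> in this direction too.\<close>

lemma R_sigma: "\<exists>b. \<forall>x. R a ((\<sigma> ^^ i) x) = (\<sigma> ^^ i) (R b x)"
proof -
  have "coprime (r ^ i) (int n)" using coprime_r by simp
  then obtain s where "[r ^ i * s = 1] (mod int n)" using cong_solve_coprime_int by blast
  then have "[r ^ i * (s * a) = a] (mod int n)"
    using cong_scalar_right[of "r ^ i * s" 1 "int n" a] by (simp add: mult.assoc)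
  then have "R (r ^ i * (s * a)) = R a" by (rule R_cong)
  then show ?thesis by (intro exI[of _ "s * a"]) (simp add: sigma_R)
qed

text \<open>Conjugation by \<open>\<sigma> ^^ i\<close> turns a power of \<open>\<rho>\<close>
  fixing \<open>(\<sigma> ^^ i) u\<close> into one fixing \<open>u\<close>, which is
  trivial.\<close>

lemma R_sigma_eq_iff: "R a ((\<sigma> ^^ i) u) = R b ((\<sigma> ^^ i) u) \<longleftrightarrow> [a = b] (mod int n)"
proof
  assume *: "R a ((\<sigma> ^^ i) u) = R b ((\<sigma> ^^ i) u)"
  have "R (a - b) ((\<sigma> ^^ i) u) = R (- b) (R a ((\<sigma> ^^ i) u))" by (simp add: R_R)
  then have fixed: "R (a - b) ((\<sigma> ^^ i) u) = (\<sigma> ^^ i) u" using * by (simp add: R_R)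
  obtain c where c: "R (a - b) ((\<sigma> ^^ i) x) = (\<sigma> ^^ i) (R c x)" for x using R_sigma by blast
  then have "R c u = R 0 u" using fixed inj_P[OF sigma_P[of i]] by (simp add: inj_eq)
  then have "R c = R 0" unfolding R_u_eq_iff by (rule R_cong)
  have "R (a - b) x = x" for x
  proof -
    obtain y where "x = (\<sigma> ^^ i) y" using surj_P[OF sigma_P[of i]] by (metis surjD)
    then show ?thesis using c[of y] \<open>R c = R 0\<close> by simp
  qed
  then have "R (a - b) u = R 0 u" by simp
  then have "[a - b = 0] (mod int n)" unfolding R_u_eq_iff .
  then show "[a = b] (mod int n)" by (simp add: cong_iff_dvd_diff)
qed (use R_cong in metis)

text \<open>Defined for all \<open>i\<close> and \<open>j\<close>, not only for representatives;
  wrapping around then becomes the equations \<open>coord_mod\<close> and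
  \<open>coord_m\<close>.\<close>

definition coord :: "nat \<times> int \<Rightarrow> 'a" where "coord = (\<lambda>(i, j). R j ((\<sigma> ^^ i) u))"

definition m :: nat where "m = (LEAST k. k > 0 \<and> (\<sigma> ^^ k) u \<in> T u)"

lemma m: "m > 0" "(\<sigma> ^^ m) u \<in> T u"
proof -
  obtain N where "\<sigma> ^^ N = id" "N > 0" using sigma_order by blast
  then have "N > 0 \<and> (\<sigma> ^^ N) u \<in> T u" by simp
  from LeastI[of "\<lambda>k. k > 0 \<and> (\<sigma> ^^ k) u \<in> T u", OF this]
  show "m > 0" "(\<sigma> ^^ m) u \<in> T u" by (auto simp: m_def)
qed

lemma m_least: "k > 0 \<Longrightarrow> (\<sigma> ^^ k) u \<in> T u \<Longrightarrow> m \<le> k"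
  unfolding m_def by (rule Least_le) auto

text \<open>Cancelling \<open>\<sigma> ^^ i\<close> leaves \<open>(\<sigma> ^^ (i' - i)) u\<close>
  in \<open>T u\<close>, so minimality of \<open>m\<close> makes the exponent vanish.\<close>

lemma coord_inj_aux:
  assumes "coord (i, j) = coord (i', j')" "i \<le> i'" "i' < m"
  shows "i = i'" and "[j = j'] (mod int n)"
proof -
  obtain b where b: "R j ((\<sigma> ^^ i) x) = (\<sigma> ^^ i) (R b x)" for x using R_sigma by blast
  obtain b' where b': "R j' ((\<sigma> ^^ i) x) = (\<sigma> ^^ i) (R b' x)" for x using R_sigma by blast
  have "(\<sigma> ^^ i') u = (\<sigma> ^^ i) ((\<sigma> ^^ (i' - i)) u)"
    using assms(2) by (metis add_diff_inverse_nat comp_apply funpow_add not_less)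
  then have "(\<sigma> ^^ i) (R b u) = (\<sigma> ^^ i) (R b' ((\<sigma> ^^ (i' - i)) u))"
    using assms(1) b b' by (simp add: coord_def)
  then have "R b u = R b' ((\<sigma> ^^ (i' - i)) u)"
    using inj_P[OF sigma_P[of i]] by (metis injD)
  then have "R (- b') (R b u) = (\<sigma> ^^ (i' - i)) u" by (simp add: R_R)
  then have "(\<sigma> ^^ (i' - i)) u \<in> T u" unfolding T_u by (metis R_R rangeI)
  then show "i = i'" using m_least[of "i' - i"] assms by force
  then show "[j = j'] (mod int n)" using assms(1) by (simp add: coord_def R_sigma_eq_iff)
qed

lemma coord_inj: "inj_on coord ({0..<m} \<times> {0..<int n})"
proof (rule inj_onI, clarify)
  fix i j i' j' assume *: "i \<in> {0..<m}" "j \<in> {0..<int n}" "i' \<in> {0..<m}" "j' \<in> {0..<int n}"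
    "coord (i, j) = coord (i', j')"
  then have "i = i' \<and> [j = j'] (mod int n)"
    using coord_inj_aux[of i j i' j'] coord_inj_aux[of i' j' i j] by (cases "i \<le> i'") (auto simp: cong_sym)
  then show "i = i' \<and> j = j'" using * by (auto intro: cong_less_imp_eq_int)
qed

text \<open>The out-neighbours of \<open>u\<close> are \<open>\<sigma> u\<close> and
  \<open>\<rho> (\<sigma> u)\<close>; transport by \<open>R j\<close> after
  \<open>\<sigma> ^^ i\<close> moves \<open>\<rho>\<close> past \<open>\<sigma> ^^ i\<close>, which
  produces the offset \<open>r ^ i\<close>.\<close>

lemma coord_out: "D `` {coord (i, j)} = {coord (Suc i, j), coord (Suc i, j + r ^ i)}"
proof -
  have "D `` {coord (i, j)} = R j ` (\<sigma> ^^ i) ` (D `` {u})"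
    using image_out[OF R_P] image_out[OF sigma_P] by (simp add: coord_def)
  also have "\<dots> = {coord (Suc i, j), coord (Suc i, j + r ^ i)}"
    using out_u sigma(2)[symmetric] by (simp add: coord_def R_1 sigma_R R_R funpow_swap1)
  finally show ?thesis .
qed

lemma coord_cong: "[j = j'] (mod int n) \<Longrightarrow> coord (i, j) = coord (i, j')"
  using R_cong by (auto simp: coord_def)

lemma coord_mod: "coord (i, j mod int n) = coord (i, j)"
  by (rule coord_cong) simp

text \<open>Both sides map \<open>u\<close> to \<open>R 1 v\<close> and \<open>R 1 u\<close> to
  \<open>R (1 - r) v\<close>. Two tails are compared instead of the arc \<open>(u, v)\<close>, since
  the image of \<open>\<sigma> v\<close> under \<open>\<tau>\<close> is not yet known.\<close>

lemma tau_sigma: "\<tau> (\<sigma> x) = R 1 (\<sigma> (\<tau> x))"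
proof -
  have "\<tau> \<circ> \<sigma> = R 1 \<circ> \<sigma> \<circ> \<tau>"
  proof (rule agree_on_tails)
    show "(\<tau> \<circ> \<sigma>) u = (R 1 \<circ> \<sigma> \<circ> \<tau>) u" using tau sigma by (simp add: R_1)
    have "(\<tau> \<circ> \<sigma>) (R 1 u) = R (1 - r) v"
      using sigma_R[of 1 1 u] tau sigma by (simp add: tau_R R_R R_1)
    moreover have "(R 1 \<circ> \<sigma> \<circ> \<tau>) (R 1 u) = R (1 - r) v"
      using sigma_R[of 1 "-1" u] tau sigma by (simp add: tau_R R_R)
    ultimately show "(\<tau> \<circ> \<sigma>) (R 1 u) = (R 1 \<circ> \<sigma> \<circ> \<tau>) (R 1 u)" by simp
  qed (use tau sigma R_P comp_closed in auto)
  then show ?thesis by (metis comp_apply)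
qed

text \<open>Each passage of \<open>\<tau>\<close> across a \<open>\<sigma>\<close> releases a factor
  \<open>\<rho>\<close>; drawing it out past every \<open>\<sigma>\<close> on its left multiplies
  its exponent by \<open>r\<close>, and the exponents add up to the geometric sum.\<close>

lemma tau_sigma_power: "\<tau> ((\<sigma> ^^ i) u) = R (\<Sum>k<i. r ^ k) ((\<sigma> ^^ i) u)"
proof (induction i)
  case 0
  then show ?case using tau by simp
next
  case (Suc i)
  have "\<tau> ((\<sigma> ^^ Suc i) u) = R 1 (\<sigma> (R (\<Sum>k<i. r ^ k) ((\<sigma> ^^ i) u)))"
    using Suc by (simp add: tau_sigma)
  also have "\<dots> = R (1 + r * (\<Sum>k<i. r ^ k)) ((\<sigma> ^^ Suc i) u)"
    using sigma_R[of 1] by (simp add: R_R)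
  also have "1 + r * (\<Sum>k<i. r ^ k) = (\<Sum>k<Suc i. r ^ k)"
    by (simp only: sum.lessThan_Suc_shift) (simp add: sum_distrib_left)
  finally show ?case .
qed

context
  fixes t assumes t: "(\<sigma> ^^ m) u = R t u"
begin

lemma sum_relation: "[(\<Sum>k<m. r ^ k) + 2 * t = 0] (mod int n)"
proof -
  have "R (- t) u = R ((\<Sum>k<m. r ^ k) + t) u"
    using tau_sigma_power[of m] tau by (simp add: t tau_R R_R)
  then have "[- t = (\<Sum>k<m. r ^ k) + t] (mod int n)" unfolding R_u_eq_iff .
  then have "[- t + t = (\<Sum>k<m. r ^ k) + t + t] (mod int n)" by (rule cong_add) simp
  then show ?thesis by (simp add: cong_sym_eq add.assoc)
qed

text \<open>
  The stabilizer of \<open>u\<close> leaves \<open>\<sigma>\<^sup>m = \<rho>\<^sup>t\<close> and \<open>\<sigma>\<^sup>m = \<rho>\<^sup>t \<tau>\<close>. The second would give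
  \<open>t (r - 1) = 1\<close>, which is impossible as \<open>n\<close> is even and \<open>r\<close> is odd.
\<close>

lemma power_relations: "[t * (r - 1) = 0] (mod int n)" "[r ^ m = 1] (mod int n)"
proof -
  let ?g = "R (- t) \<circ> (\<sigma> ^^ m)"
  have "?g \<in> P" "?g u = u" using R_P sigma_P comp_closed by (auto simp: t R_R)
  then have cases: "?g = id \<or> ?g = \<tau>" by (rule stabilizer)
  have sm_g: "(\<sigma> ^^ m) x = R t (?g x)" for x by (simp add: R_R)
  have v: "v = (\<sigma> ^^ 1) u" using sigma by simp
  \<comment> \<open>The vertex \<open>(\<sigma> ^^ Suc m) u\<close> is evaluated with the extra
    \<open>\<sigma>\<close> applied last and applied first.\<close>
  have "\<sigma> ((\<sigma> ^^ m) u) = (\<sigma> ^^ m) (\<sigma> u)" by (simp add: funpow_swap1)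
  then have comm: "R (r * t) v = (\<sigma> ^^ m) v"
    using sigma_R[of 1 t u] t sigma by simp
  have "?g \<noteq> \<tau>"
  proof
    assume "?g = \<tau>"
    then have "(\<sigma> ^^ m) v = R t (\<tau> v)" using sm_g[of v] by simp
    then have "R (r * t) v = R (t + 1) v" using comm tau by (simp add: R_1 R_R)
    then have "[r * t = t + 1] (mod int n)" unfolding v R_sigma_eq_iff .
    then have "int n dvd r * t - (t + 1)" by (simp add: cong_iff_dvd_diff)
    then have "even (r * t - (t + 1))" using n_even by (metis dvd_trans even_of_nat)
    then show False using odd_r by simp
  qed
  with cases have "?g = id" by blast
  then have sm: "(\<sigma> ^^ m) x = R t x" for x using sm_g[of x] by simp
  then have "R (r * t) v = R t v" using comm by simp
  then have "[r * t = t] (mod int n)" unfolding v R_sigma_eq_iff .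
  then show "[t * (r - 1) = 0] (mod int n)" by (simp add: cong_iff_dvd_diff algebra_simps)
  have "R (r ^ m + t) u = R (t + 1) u"
    using sigma_R[of m 1 u] sm by (simp add: R_R)
  then have "[r ^ m + t = t + 1] (mod int n)" unfolding R_u_eq_iff .
  then show "[r ^ m = 1] (mod int n)" by (simp add: cong_iff_dvd_diff)
qed

text \<open>Powers of the odd \<open>r\<close> are odd, so the geometric sum has the parity of
  \<open>m\<close>; \<open>sum_relation\<close> modulo the even \<open>n\<close> makes it
  even.\<close>

lemma even_m: "even m"
proof -
  have "even (\<Sum>k<i. r ^ k) \<longleftrightarrow> even i" for i
    by (induction i) (use odd_r in auto)
  moreover have "int n dvd (\<Sum>k<m. r ^ k) + 2 * t"
    using sum_relation by (simp add: cong_0_iff)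
  then have "even ((\<Sum>k<m. r ^ k) + 2 * t)" using n_even by (metis dvd_trans even_of_nat)
  ultimately show ?thesis by simp
qed

text \<open>\<open>m\<close> is positive and even; with \<open>m = 2\<close> the vertex
  \<open>v\<close> would lie both after and before the block \<open>T u\<close>.\<close>

lemma m_ge: "m \<ge> 4"
proof -
  have "m \<noteq> 2"
  proof
    assume "m = 2"
    then have "\<sigma> v \<in> T u" using m(2) sigma by (simp add: numeral_2_eq_2)
    moreover have "(v, \<sigma> v) \<in> D" using preserves[OF sigma(1) uv] sigma by simp
    ultimately have "v \<in> D\<inverse> `` T u" by blast
    moreover have "v \<in> D `` T u" using uv tail_class_self[of u D] by blast
    ultimately show False using out_in_disjoint[OF u_V] by blast
  qed
  moreover obtain k where "m = 2 * k" using even_m by blast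
  ultimately show ?thesis using m(1) by (cases "k = 1") auto
qed

lemma coord_m: "coord (m, j) = coord (0, j + t)"
  by (simp add: coord_def t R_R)

text \<open>The vertices with coordinates are closed under out-neighbours, the last block leading
  back to block \<open>0\<close> by \<open>coord_m\<close>, and \<open>connected_forward\<close>
  applies.\<close>

lemma coord_surj: "coord ` ({0..<m} \<times> {0..<int n}) = V"
proof (rule connected_forward)
  let ?W = "coord ` ({0..<m} \<times> {0..<int n})"
  have W: "coord (i, j) \<in> ?W" if "i < m" for i j
    by (rule image_eqI[of _ _ "(i, j mod int n)"]) (use that n_ge in \<open>auto simp: coord_mod\<close>)
  show "?W \<subseteq> V"
    using in_V[OF R_P] in_V[OF sigma_P] u_V by (auto simp: coord_def)
  show "?W \<noteq> {}" using W[OF m(1)] by blast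
  show "D `` ?W \<subseteq> ?W"
  proof
    fix y assume "y \<in> D `` ?W"
    then obtain i j where ij: "i < m" "y \<in> D `` {coord (i, j)}" by auto
    then obtain k where k: "y = coord (Suc i, k)" unfolding coord_out by auto
    show "y \<in> ?W"
    proof (cases "Suc i = m")
      case True
      then show ?thesis using W[OF m(1)] k coord_m by simp
    next
      case False
      then show ?thesis using W k ij by auto
    qed
  qed
qed

lemma half_arcs: "(\<lambda>(p, q). (coord p, coord q)) ` Xe_half_arcs m n r t = D"
proof (intro subset_antisym subsetI)
  fix e assume "e \<in> (\<lambda>(p, q). (coord p, coord q)) ` Xe_half_arcs m n r t"
  then obtain p q where pq: "(p, q) \<in> Xe_half_arcs m n r t" "e = (coord p, coord q)" by auto
  obtain i j where p: "p = (i, j)" by (cases p)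
  have "coord q \<in> {coord (Suc i, j), coord (Suc i, j + r ^ i)}"
  proof (cases "i = m - 1")
    case True
    then have "Suc i = m" using m by simp
    then show ?thesis
      using pq p coord_m by (auto simp: Xe_half_arcs_def coord_mod)
  next
    case False
    then show ?thesis
      using pq p by (auto simp: Xe_half_arcs_def coord_mod)
  qed
  then have "coord q \<in> D `` {coord p}" unfolding p coord_out .
  then show "e \<in> D" using pq by auto
next
  fix e assume e: "e \<in> D"
  obtain x y where xy: "e = (x, y)" by (cases e)
  then have "x \<in> V" using e arc_V by blast
  then obtain i j where ij: "i < m" "j \<in> {0..<int n}" "x = coord (i, j)"
    using coord_surj by auto
  have "y \<in> D `` {coord (i, j)}" using e xy ij by auto
  then consider "y = coord (Suc i, j)" | "y = coord (Suc i, j + r ^ i)"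
    unfolding coord_out by auto
  then have "\<exists>q. y = coord q \<and> ((i, j), q) \<in> Xe_half_arcs m n r t"
  proof cases
    case 1
    show ?thesis
    proof (cases "Suc i = m")
      case True
      then have "i = m - 1" by simp
      then have "((i, j), (0, (j + t) mod int n)) \<in> Xe_half_arcs m n r t"
        using ij by (auto simp: Xe_half_arcs_def)
      then show ?thesis using 1 True coord_m coord_mod by metis
    next
      case False
      then have "i \<in> {0..<m - 1}" using ij by auto
      then have "((i, j), (Suc i, j)) \<in> Xe_half_arcs m n r t"
        using ij unfolding Xe_half_arcs_def by (intro UnI1 UN_I[of i] UN_I[of j]) auto
      then show ?thesis using 1 by metis
    qed
  next
    case 2
    show ?thesis
    proof (cases "Suc i = m")
      case True
      then have "i = m - 1" by simp
      then have "((i, j), (0, (j + r ^ i + t) mod int n)) \<in> Xe_half_arcs m n r t"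
        using ij by (auto simp: Xe_half_arcs_def)
      then show ?thesis using 2 True coord_m coord_mod by metis
    next
      case False
      then have "i \<in> {0..<m - 1}" using ij by auto
      then have "((i, j), (Suc i, (j + r ^ i) mod int n)) \<in> Xe_half_arcs m n r t"
        using ij unfolding Xe_half_arcs_def by (intro UnI1 UN_I[of i] UN_I[of j]) auto
      then show ?thesis using 2 coord_mod by metis
    qed
  qed
  then obtain q where "y = coord q" "((i, j), q) \<in> Xe_half_arcs m n r t" by blast
  then show "e \<in> (\<lambda>(p, q). (coord p, coord q)) ` Xe_half_arcs m n r t"
    using xy ij by force
qed

end

end

theorem (in tight_digraph) coordinates:
  obtains m r t c where "even m" "m \<ge> 4" "r \<in> {0..<int n}" "coprime r (int n)" "t \<in> {0..<int n}"
    "[r ^ m = 1] (mod int n)" "[t * (r - 1) = 0] (mod int n)"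
    "[(\<Sum>i = 0..m - 1. r ^ i) + 2 * t = 0] (mod int n)"
    "bij_betw c ({0..<m} \<times> {0..<int n}) V"
    "(\<lambda>(p, q). (c p, c q)) ` Xe_half_arcs m n r t = D"
proof -
  obtain u where "u \<in> V" using V_nonempty by blast
  then obtain v where uv: "(u, v) \<in> D" using out_arc by blast
  then obtain \<rho> where rot: "rotation_at V D P u v \<rho>" using exists_rotation_at by blast
  obtain \<tau> where \<tau>: "\<tau> \<in> P" "\<tau> u = u" "\<tau> v \<noteq> v" "D `` {u} = {v, \<tau> v}"
    using reflection[OF uv] by metis
  then have "\<tau> v = \<rho> v" using rotation_at.out_u[OF rot] by auto
  obtain \<sigma> where "\<sigma> \<in> P" "\<sigma> u = v" using vertex_transitive[of u v] arc_V[OF uv] by blast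
  then have "framed_digraph V D P n u v \<rho> \<sigma> \<tau>"
    using rot \<tau> \<open>\<tau> v = \<rho> v\<close> tight_digraph_axioms
    unfolding framed_digraph_def framed_digraph_axioms_def by blast
  then interpret F: framed_digraph V D P n u v \<rho> \<sigma> \<tau> .
  obtain r where "r \<in> {0..<int n}" "\<forall>x. \<sigma> (\<rho> x) = F.R r (\<sigma> x)" using F.sigma_normalizes by blast
  then interpret C: coordinatized_digraph V D P n u v \<rho> \<sigma> \<tau> r by unfold_locales auto
  obtain t' where "(\<sigma> ^^ C.m) u = F.R t' u" using C.m(2) F.T_u by auto
  then have t: "(\<sigma> ^^ C.m) u = F.R (t' mod int n) u"
    using F.R_cong[of "t' mod int n" t'] by simp
  have sum: "(\<Sum>i = 0..C.m - 1. r ^ i) = (\<Sum>k<C.m. r ^ k)"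
    using C.m(1) by (intro sum.cong) auto
  show ?thesis
  proof (rule that)
    show "bij_betw C.coord ({0..<C.m} \<times> {0..<int n}) V"
      using C.coord_inj C.coord_surj[OF t] by (simp add: bij_betw_def)
  qed (use C.even_m[OF t] C.m_ge[OF t] C.r_range C.coprime_r C.power_relations[OF t]
      C.sum_relation[OF t] C.half_arcs[OF t] sum n_ge in auto)
qed

section \<open>Alternating cycles of the graph\<close>

context half_arc_digraph begin

abbreviation cycle_set where "cycle_set x \<equiv> T x \<union> D `` T x"

text \<open>The vertices shared by the two alternating cycles through \<open>x\<close>, one having
  \<open>x\<close> as a tail and the other as a head.\<close>

abbreviation common where "common x \<equiv> cycle_set x \<inter> (H x \<union> D\<inverse> `` H x)"

text \<open>Vertex-transitivity; with \<open>adjacent_common\<close> this makes the attachment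
  number independent of the pair of cycles.\<close>

lemma card_common: assumes "x \<in> V" "y \<in> V" shows "card (common x) = card (common y)"
proof -
  interpret dual: half_arc_digraph V "D\<inverse>" P by (rule dual)
  obtain f where f: "f \<in> P" "f x = y" using vertex_transitive assms by blast
  have "f ` T x = T y" "f ` H x = H y"
    using tail_class_image[OF f(1)] dual.tail_class_image[OF f(1)] f(2) by auto
  then have "f ` common x = common y"
    using image_out[OF f(1)] dual.image_out[OF f(1)] inj_P[OF f(1)]
    by (simp add: image_Int image_Un)
  then show ?thesis
    using card_image[of f "common x"] inj_P[OF f(1)] inj_on_subset by (metis subset_UNIV)
qed

text \<open>Different cycles cannot meet in a tail of both or a head of both, since their tail
  classes would coincide. So a shared \<open>z\<close> is a tail of one and a head of the other, and
  they are the two cycles through \<open>z\<close>.\<close>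

lemma adjacent_common:
  assumes neq: "D \<inter> T a \<times> UNIV \<noteq> D \<inter> T b \<times> UNIV" and V: "a \<in> V" "b \<in> V"
    and ne: "cycle_set a \<inter> cycle_set b \<noteq> {}"
  obtains z where "z \<in> V" "cycle_set a \<inter> cycle_set b = common z"
proof -
  have T_neq: "T a \<noteq> T b" using neq by auto
  have D_out: "D\<inverse> `` H z = T c" "D `` T c = H z" if z: "z \<in> D `` T c" for z c
  proof -
    obtain d where d: "d \<in> T c" "(d, z) \<in> D" using z by blast
    then have "T d = T c" using tail_class_eq by metis
    then show "D\<inverse> `` H z = T c" "D `` T c = H z"
      using out_tail_class[of z d "D\<inverse>"] out_tail_class[OF d(2)] d by auto
  qed
  have main: "cycle_set a \<inter> cycle_set b = common z" if z: "z \<in> T a" "z \<in> D `` T b" for a b z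
  proof -
    have "T z = T a" using z(1) tail_class_eq by metis
    then show ?thesis using D_out[OF z(2)] by auto
  qed
  obtain z where z: "z \<in> cycle_set a" "z \<in> cycle_set b" using ne by blast
  have zV: "z \<in> V" using z tail_class_V[OF V(1)] D_subset by blast
  have "\<not> (z \<in> T a \<and> z \<in> T b)" using T_neq tail_class_disjoint by metis
  moreover have "\<not> (z \<in> D `` T a \<and> z \<in> D `` T b)" using T_neq D_out by metis
  ultimately consider "z \<in> T a" "z \<in> D `` T b" | "z \<in> T b" "z \<in> D `` T a"
    using z by blast
  then show ?thesis
  proof cases
    case 1
    then show ?thesis using main that zV by metis
  next
    case 2
    then show ?thesis using main that zV by (metis inf_commute)
  qed
qed

text \<open>By asymmetry an edge determines its arc in \<open>D\<close>, so the edges of an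
  alternating cycle determine its tails.\<close>

lemma edges_from_tail_class:
  assumes "edges_of (D \<inter> T a \<times> UNIV) = edges_of (D \<inter> T b \<times> UNIV)" "a \<in> V"
  shows "a \<in> T b"
proof -
  obtain y where y: "(a, y) \<in> D" using out_arc assms by blast
  then have "{a, y} \<in> edges_of (D \<inter> T a \<times> UNIV)"
    unfolding edges_of_def by (intro image_eqI[of _ _ "(a, y)"]) auto
  then obtain c d where "{a, y} = {c, d}" "(c, d) \<in> D" "c \<in> T b"
    unfolding assms by (auto simp: edges_of_def)
  then show ?thesis using asymmetric[OF y] by (auto simp: doubleton_eq_iff)
qed

end

section \<open>Cycles as lists of arcs, described by indices\<close>

lemma pcas_conv_nth:
  assumes "p \<noteq> []"
  shows "pcas u p w \<longleftrightarrow> fst (p ! 0) = u \<and> snd (p ! (length p - 1)) = w \<and>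
    (\<forall>i. Suc i < length p \<longrightarrow> snd (p ! i) = fst (p ! Suc i))"
  using assms
proof (induction p arbitrary: u)
  case (Cons e p)
  show ?case
  proof (cases p)
    case Nil
    then show ?thesis by auto
  next
    case (Cons e' q)
    then show ?thesis using Cons.IH
      by (auto simp: nth_Cons' less_Suc_eq_0_disj split: nat.splits)
  qed
qed simp

lemma cycle_conv_nth:
  assumes X: "pair_graph X" and p: "length p > 2"
  shows "pre_digraph.cycle (with_proj X) p \<longleftrightarrow> set p \<subseteq> parcs X \<and> distinct (map fst p) \<and>
    (\<forall>i < length p. snd (p ! i) = fst (p ! (Suc i mod length p)))"
proof -
  interpret pair_graph X by fact
  have ne: "p \<noteq> []" using p by auto
  have "(\<forall>i < length p. snd (p ! i) = fst (p ! (Suc i mod length p))) \<longleftrightarrow> (\<exists>u. pcas u p u)"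
  proof -
    have "(\<forall>i < length p. snd (p ! i) = fst (p ! (Suc i mod length p))) \<longleftrightarrow>
      snd (p ! (length p - 1)) = fst (p ! 0) \<and>
      (\<forall>i. Suc i < length p \<longrightarrow> snd (p ! i) = fst (p ! Suc i))" (is "?L \<longleftrightarrow> ?R")
    proof
      assume L: ?L
      have "Suc (length p - 1) = length p" using p by simp
      with L[rule_format, of "length p - 1"] p have "snd (p ! (length p - 1)) = fst (p ! 0)" by simp
      moreover have "snd (p ! i) = fst (p ! Suc i)" if "Suc i < length p" for i
        using L[rule_format, of i] that by simp
      ultimately show ?R by blast
    next
      assume R: ?R
      show ?L
      proof clarify
        fix i assume "i < length p"
        then consider "Suc i < length p" | "i = length p - 1" "Suc i = length p" by linarith
        then show "snd (p ! i) = fst (p ! (Suc i mod length p))" using R p by cases auto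
      qed
    qed
    then show ?thesis using pcas_conv_nth[OF ne] by auto
  qed
  moreover have "distinct (tl (pawalk_verts u p)) \<longleftrightarrow> distinct (map fst p)" if "pcas u p u" for u
  proof -
    have "fst (hd p) = u" "snd (last p) = u"
      using that ne by (auto simp: pcas_conv_nth hd_conv_nth last_conv_nth)
    \<comment> \<open>The walk is closed, so dropping the start of its vertex list leaves the tails
      of its arcs rotated by one place.\<close>
    then have "tl (pawalk_verts u p) = rotate1 (map fst p)"
      using ne awalk_verts_conv[of u p] by (cases p) auto
    then show ?thesis by simp
  qed
  moreover have "u \<in> pverts X" if "pcas u p u" "set p \<subseteq> parcs X" for u
    using that ne by (auto simp: pcas_conv_nth intro!: arc_fst_in_verts)
  ultimately show ?thesis
    unfolding cycle_def awalk_def using ne by auto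
qed

section \<open>From the group action to an orientation\<close>

definition extend :: "'a set \<Rightarrow> ('a \<Rightarrow> 'a) \<Rightarrow> 'a \<Rightarrow> 'a" where
  "extend V f x = (if x \<in> V then f x else x)"

lemma subgroup_Aut_D:
  assumes G: "subgroup G (Aut X)"
  shows "g \<in> G \<Longrightarrow> bij_betw g (pverts X) (pverts X)"
    and "g \<in> G \<Longrightarrow> u \<in> pverts X \<Longrightarrow> v \<in> pverts X \<Longrightarrow> (g u, g v) \<in> parcs X \<longleftrightarrow> (u, v) \<in> parcs X"
    and "f \<in> G \<Longrightarrow> g \<in> G \<Longrightarrow> \<exists>h\<in>G. \<forall>x\<in>pverts X. h x = f (g x)"
    and "f \<in> G \<Longrightarrow> \<exists>h\<in>G. \<forall>x\<in>pverts X. h (f x) = x \<and> f (h x) = x"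
proof -
  interpret Aut: group "Aut X" by (rule group_Aut)
  have aut: "g \<in> automorphisms X" if "g \<in> G" for g
    using subgroup.subset[OF G] that by (auto simp: Aut_def)
  then show "bij_betw g (pverts X) (pverts X)" if "g \<in> G" for g
    using that by (auto simp: automorphisms_def Bij_def)
  show "(g u, g v) \<in> parcs X \<longleftrightarrow> (u, v) \<in> parcs X"
    if "g \<in> G" "u \<in> pverts X" "v \<in> pverts X" for g u v
    using that aut by (auto simp: automorphisms_def)
  have mult: "f \<otimes>\<^bsub>Aut X\<^esub> g = compose (pverts X) f g" if "f \<in> G" "g \<in> G" for f g
    using aut[OF that(1)] aut[OF that(2)] by (auto simp: Aut_def BijGroup_def automorphisms_def)
  show "\<exists>h\<in>G. \<forall>x\<in>pverts X. h x = f (g x)" if "f \<in> G" "g \<in> G" for f g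
    using subgroup.m_closed[OF G that] unfolding mult[OF that] compose_def
    by (rule bexI[rotated]) simp
  show "\<exists>h\<in>G. \<forall>x\<in>pverts X. h (f x) = x \<and> f (h x) = x" if f: "f \<in> G" for f
  proof -
    let ?h = "inv\<^bsub>Aut X\<^esub> f"
    have h: "?h \<in> G" using subgroup.m_inv_closed[OF G f] .
    have "f \<in> carrier (Aut X)" using f subgroup.subset[OF G] by blast
    then have "compose (pverts X) ?h f = \<one>\<^bsub>Aut X\<^esub>" "compose (pverts X) f ?h = \<one>\<^bsub>Aut X\<^esub>"
      using mult[OF h f] mult[OF f h] Aut.l_inv Aut.r_inv by auto
    moreover have "\<one>\<^bsub>Aut X\<^esub> = (\<lambda>x\<in>pverts X. x)" by (simp add: Aut_def BijGroup_def)
    ultimately have "?h (f x) = x \<and> f (?h x) = x" if "x \<in> pverts X" for x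
      using that by (metis compose_eq restrict_apply')
    then show ?thesis using h by blast
  qed
qed

text \<open>Edge-transitivity makes one arc orbit \<open>D\<close> cover every edge, and an edge
  covered in both directions would make \<open>G\<close> transitive on arcs. Vertex-transitivity
  gives constant in- and out-degrees, which are equal by counting \<open>D\<close> and add up to
  \<open>4\<close>.\<close>

lemma half_arc_digraph_orientation:
  fixes X :: "'a pair_pre_digraph" and G :: "('a \<Rightarrow> 'a) set"
  assumes X: "pair_graph X"
    and conn: "Digraph_Component.connected (with_proj X)"
    and deg: "\<forall>v \<in> pverts X. out_degree (with_proj X) v = 4"
    and G: "half_arc_transitive X G"
  obtains D where "half_arc_digraph (pverts X) D (extend (pverts X) ` G)"
    "parcs X = D \<union> D\<inverse>" "orientation X G D" "\<And>D'. orientation X G D' \<Longrightarrow> D' = D \<or> D' = D\<inverse>"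
proof -
  interpret X: pair_graph X by fact
  let ?V = "pverts X" and ?E = "parcs X"
  have sub: "subgroup G (Aut X)" using G by (simp add: half_arc_transitive_def)
  note GD = subgroup_Aut_D[OF sub]
  have vt: "\<exists>g\<in>G. g x = y" if "x \<in> ?V" "y \<in> ?V" for x y
    using G that by (auto simp: half_arc_transitive_def transitive_on_def)
  have et: "\<exists>g\<in>G. g ` {x, y} = {x', y'}" if "(x, y) \<in> ?E" "(x', y') \<in> ?E" for x y x' y'
  proof -
    have "{x, y} \<in> edges_of ?E" "{x', y'} \<in> edges_of ?E"
      using that by (auto simp: edges_of_def intro: rev_image_eqI)
    then show ?thesis using G by (auto simp: half_arc_transitive_def transitive_on_def)
  qed
  have sc: "strongly_connected (with_proj X)"
    using X.symmetric_connected_imp_strongly_connected[OF X.pair_sym_arcs conn] .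
  then have V_ne: "?V \<noteq> {}" by (simp add: strongly_connected_def)
  then obtain a0 where a0: "a0 \<in> ?V" by auto
  have out_E: "card (?E `` {x}) = 4" if "x \<in> ?V" for x
  proof -
    have "out_arcs (with_proj X) x = Pair x ` (?E `` {x})" by (auto simp: out_arcs_def)
    then have "card (?E `` {x}) = out_degree (with_proj X) x"
      by (simp add: out_degree_def card_image inj_on_def)
    then show ?thesis using deg that by simp
  qed
  then have "?E `` {a0} \<noteq> {}" using a0 by (metis card.empty zero_neq_numeral)
  then obtain a b where ab: "(a, b) \<in> ?E" by auto
  then have ab_V: "a \<in> ?V" "b \<in> ?V" by (auto dest: X.in_arcsD1 X.in_arcsD2)
  have sym: "(y, x) \<in> ?E" if "(x, y) \<in> ?E" for x y using X.arcs_symmetric that by blast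
  have E_V: "?E \<subseteq> ?V \<times> ?V" by (auto dest: X.in_arcsD1 X.in_arcsD2)
  define D where "D = {(g a, g b) | g. g \<in> G}"
  have G_V: "g x \<in> ?V" if "g \<in> G" "x \<in> ?V" for g x
    using GD(1)[OF that(1)] that(2) by (auto simp: bij_betw_def)
  have D_E: "D \<subseteq> ?E" using GD(2) ab ab_V by (auto simp: D_def)
  have pres: "(g x, g y) \<in> D" if g: "g \<in> G" and xy: "(x, y) \<in> D" for g x y
  proof -
    obtain f where f: "f \<in> G" "x = f a" "y = f b" using xy by (auto simp: D_def)
    obtain h where h: "h \<in> G" "\<forall>x\<in>?V. h x = g (f x)" using GD(3)[OF g f(1)] by blast
    then have "(g x, g y) = (h a, h b)" using f ab_V by simp
    then show ?thesis using h unfolding D_def by blast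
  qed
  have trans: "\<exists>g\<in>G. g x = x' \<and> g y = y'" if arcs: "(x, y) \<in> D" "(x', y') \<in> D" for x y x' y'
  proof -
    obtain f f' where f: "f \<in> G" "x = f a" "y = f b" "f' \<in> G" "x' = f' a" "y' = f' b"
      using arcs by (auto simp: D_def)
    obtain h where h: "h \<in> G" "\<forall>x\<in>?V. h (f x) = x \<and> f (h x) = x" using GD(4)[OF f(1)] by blast
    obtain k where k: "k \<in> G" "\<forall>x\<in>?V. k x = f' (h x)" using GD(3)[OF f(4) h(1)] by blast
    then have "k x = x'" "k y = y'" using f h ab_V G_V[OF f(1)] by auto
    then show ?thesis using k by blast
  qed
  have ab_D: "(a, b) \<in> D"
  proof -
    obtain f where f: "f \<in> G" using vt a0 by blast
    then obtain h where h: "h \<in> G" "\<forall>x\<in>?V. h (f x) = x \<and> f (h x) = x" using GD(4) by blast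
    then have "(f a, f b) \<in> D" using f by (auto simp: D_def)
    from pres[OF h(1) this] show ?thesis using h ab_V by simp
  qed
  have E_eq: "?E = D \<union> D\<inverse>"
  proof
    show "?E \<subseteq> D \<union> D\<inverse>"
    proof (rule subrelI)
      fix x y assume xy: "(x, y) \<in> ?E"
      obtain g where g: "g \<in> G" "g ` {a, b} = {x, y}" using et[OF ab xy] by blast
      then have "(g a, g b) \<in> D" by (auto simp: D_def)
      moreover have "(x, y) = (g a, g b) \<or> (y, x) = (g a, g b)"
        using g by (auto simp: doubleton_eq_iff)
      ultimately show "(x, y) \<in> D \<union> D\<inverse>" by auto
    qed
    show "D \<union> D\<inverse> \<subseteq> ?E" using D_E sym by auto
  qed
  have asym: "(y, x) \<notin> D" if xy: "(x, y) \<in> D" for x y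
  proof
    assume yx: "(y, x) \<in> D"
    have "(q, p) \<in> D" if pq: "(p, q) \<in> D" for p q
      using trans[OF xy pq] pres[OF _ yx] by blast
    then have "?E = D" using E_eq by auto
    then have "transitive_on G (\<lambda>g (u, v). (g u, g v)) ?E"
      unfolding transitive_on_def using trans by fastforce
    then show False using G by (simp add: half_arc_transitive_def)
  qed
  have D_V: "D \<subseteq> ?V \<times> ?V" using D_E E_V by auto
  have fin_D: "finite D" using D_E X.pair_finite_arcs finite_subset by blast
  have img: "card (D `` {x}) \<le> card (D `` {y}) \<and> card (D\<inverse> `` {x}) \<le> card (D\<inverse> `` {y})"
    if xy: "x \<in> ?V" "y \<in> ?V" for x y
  proof -
    obtain g where g: "g \<in> G" "g x = y" using vt xy by blast
    have inj: "inj_on g (D `` {x})" "inj_on g (D\<inverse> `` {x})"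
      using GD(1)[OF g(1)] D_V by (auto simp: bij_betw_def intro: inj_on_subset)
    have fin: "finite (D `` {y})" "finite (D\<inverse> `` {y})"
      using D_V X.pair_finite_verts by (auto intro: finite_subset)
    have "g ` (D `` {x}) \<subseteq> D `` {y}" "g ` (D\<inverse> `` {x}) \<subseteq> D\<inverse> `` {y}"
      using pres[OF g(1)] g(2) by auto
    then show ?thesis
      using card_mono[OF fin(1)] card_mono[OF fin(2)] card_image[OF inj(1)] card_image[OF inj(2)]
      by metis
  qed
  have two: "card (D `` {x}) = 2 \<and> card (D\<inverse> `` {x}) = 2" if x: "x \<in> ?V" for x
  proof -
    have "card D = card (D `` {x}) * card ?V"
      by (rule card_relation_const) (use D_V fin_D X.pair_finite_verts img x in \<open>auto intro: le_antisym\<close>)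
    moreover have "card (D\<inverse>) = card (D\<inverse> `` {x}) * card ?V"
      by (rule card_relation_const) (use D_V fin_D X.pair_finite_verts img x in \<open>auto intro: le_antisym\<close>)
    moreover have "card ?V > 0" using V_ne X.pair_finite_verts by (simp add: card_gt_0_iff)
    ultimately have eq: "card (D `` {x}) = card (D\<inverse> `` {x})" by (auto simp: card_inverse)
    have "?E `` {x} = D `` {x} \<union> D\<inverse> `` {x}" "D `` {x} \<inter> D\<inverse> `` {x} = {}"
      using E_eq asym by auto
    moreover have "finite (D `` {x})" "finite (D\<inverse> `` {x})"
      using D_V X.pair_finite_verts by (auto intro: finite_subset)
    ultimately have "4 = card (D `` {x}) + card (D\<inverse> `` {x})"
      using out_E[OF x] by (simp add: card_Un_disjoint)
    then show ?thesis using eq by simp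
  qed
  \<comment> \<open>\<open>extend\<close> replaces \<open>undefined\<close> off the vertex set by
    the identity, turning elements of \<open>G\<close> into permutations of the type.\<close>
  have dig: "half_arc_digraph ?V D (extend ?V ` G)"
  proof
    show "finite ?V" by (rule X.pair_finite_verts)
    show "?V \<noteq> {}" by (rule V_ne)
    show "D \<subseteq> ?V \<times> ?V" by (rule D_V)
    show "f permutes ?V" if f: "f \<in> extend ?V ` G" for f
    proof -
      obtain g where g: "g \<in> G" "f = extend ?V g" using f by blast
      have "bij_betw f ?V ?V"
        using GD(1)[OF g(1)] by (rule bij_betw_cong[THEN iffD1, rotated]) (simp add: g extend_def)
      then show ?thesis by (rule bij_imp_permutes) (simp add: g extend_def)
    qed
    show "f \<circ> g \<in> extend ?V ` G" if ext: "f \<in> extend ?V ` G" "g \<in> extend ?V ` G" for f g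
    proof -
      obtain f' g' where fg: "f' \<in> G" "f = extend ?V f'" "g' \<in> G" "g = extend ?V g'"
        using ext by blast
      obtain h where h: "h \<in> G" "\<forall>x\<in>?V. h x = f' (g' x)" using GD(3)[OF fg(1,3)] by blast
      have "f \<circ> g = extend ?V h" using fg h G_V by (auto simp: extend_def)
      then show ?thesis using h by blast
    qed
    show "inv_into UNIV f \<in> extend ?V ` G" if f: "f \<in> extend ?V ` G" for f
    proof -
      obtain f' where f': "f' \<in> G" "f = extend ?V f'" using f by blast
      obtain h where h: "h \<in> G" "\<forall>x\<in>?V. h (f' x) = x \<and> f' (h x) = x" using GD(4)[OF f'(1)] by blast
      have "inv_into UNIV f = extend ?V h"
        by (rule inv_unique_comp) (use f' h G_V in \<open>auto simp: extend_def\<close>)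
      then show ?thesis using h by blast
    qed
    show "(f x, f y) \<in> D" if "f \<in> extend ?V ` G" "(x, y) \<in> D" for f x y
      using that pres D_V by (auto simp: extend_def)
    show "\<exists>f\<in>extend ?V ` G. f x = x' \<and> f y = y'"
      if arcs: "(x, y) \<in> D" "(x', y') \<in> D" for x y x' y'
    proof -
      obtain g where "g \<in> G" "g x = x'" "g y = y'" using trans[OF arcs] by blast
      then show ?thesis using D_V arcs by (intro bexI[of _ "extend ?V g"]) (auto simp: extend_def)
    qed
    show "card (D `` {x}) = 2" "card (D\<inverse> `` {x}) = 2" if "x \<in> ?V" for x using two that by auto
    show "(y, x) \<notin> D" if "(x, y) \<in> D" for x y using asym that .
    show "S = ?V" if S: "S \<subseteq> ?V" "S \<noteq> {}" "D `` S \<subseteq> S" "D\<inverse> `` S \<subseteq> S" for S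
    proof -
      have cl: "?E `` S \<subseteq> S" using S E_eq by blast
      obtain s where s: "s \<in> S" using S by blast
      have "v \<in> S" if "v \<in> ?V" for v
      proof -
        have "s \<rightarrow>\<^sup>*\<^bsub>with_proj X\<^esub> v" using sc s S that by (auto simp: strongly_connected_def)
        then have "(s, v) \<in> ?E\<^sup>*" using reachable_rtranclI by fastforce
        then show ?thesis using Image_closed_trancl[OF cl] s by blast
      qed
      then show ?thesis using S by blast
    qed
  qed
  have ori: "D' = D \<or> D' = D\<inverse>" if D': "orientation X G D'" for D'
  proof -
    obtain c d where cd: "(c, d) \<in> ?E" "D' = {(g c, g d) | g. g \<in> G}"
      using D' by (auto simp: orientation_def)
    \<comment> \<open>Any arc of \<open>D\<close> generates the same orbit; an arc against
      \<open>D\<close> generates the reversed one.\<close>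
    have *: "{(g c, g d) | g. g \<in> G} = D" if "(c, d) \<in> D" for c d
      using trans[OF that] pres[OF _ that] by fastforce
    have "(c, d) \<in> D \<or> (d, c) \<in> D" using cd E_eq by blast
    then show ?thesis
    proof
      assume "(d, c) \<in> D"
      then have "{(g d, g c) | g. g \<in> G} = D" by (rule *)
      then show ?thesis unfolding cd by auto
    qed (use * cd in auto)
  qed
  show ?thesis
    by (rule that[OF dig E_eq _ ori]) (use ab in \<open>auto simp: orientation_def D_def\<close>)
qed

section \<open>Translation between arc lists and alternating sequences\<close>

lemma alternating_cycle_sequence:
  assumes X: "pair_graph X" and p: "alternating_cycle X G p"
    and ori: "\<And>D'. orientation X G D' \<Longrightarrow> D' = D \<or> D' = D\<inverse>"
  obtains y where "alternating_sequence D y (length p)" "cycle_verts p = range y"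
    "edges_of (set p) = range (\<lambda>i. {y i, y (Suc i)})"
proof -
  define L where "L = length p"
  define x where "x i = fst (p ! (i mod L))" for i
  have L: "L > 2" "even L" using p by (auto simp: alternating_cycle_def L_def)
  have cyc: "distinct (map fst p)" "\<forall>i < L. snd (p ! i) = fst (p ! (Suc i mod L))"
    using p cycle_conv_nth[OF X, of p] by (auto simp: alternating_cycle_def L_def)
  obtain D' parity where D': "orientation X G D'" and
    alt: "\<forall>i < L. if even i = parity then (x i, x (i + L - 1)) \<in> D' \<and> (x i, x (i + 1)) \<in> D'
                   else (x (i + L - 1), x i) \<in> D' \<and> (x (i + 1), x i) \<in> D'"
  proof -
    obtain D' parity where D': "orientation X G D'" and
      a: "\<forall>i < length p.
           let u = fst (p ! ((i + length p - 1) mod length p));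
               v = fst (p ! i);
               w = fst (p ! ((i + 1) mod length p))
           in if even i = parity
              then (v, u) \<in> D' \<and> (v, w) \<in> D'
              else (u, v) \<in> D' \<and> (w, v) \<in> D'"
      using p unfolding alternating_cycle_def by blast
    show ?thesis
      by (rule that[OF D', of parity]) (use a in \<open>simp add: Let_def x_def L_def\<close>)
  qed
  obtain tail_parity where
    alt': "\<forall>i < L. if even i = tail_parity then (x i, x (i + L - 1)) \<in> D \<and> (x i, x (i + 1)) \<in> D
                   else (x (i + L - 1), x i) \<in> D \<and> (x (i + 1), x i) \<in> D"
  proof (cases "D' = D")
    case True
    then show ?thesis using that[of parity] alt by blast
  next
    case False
    then have D'_eq: "D' = D\<inverse>" using ori D' by blast
    \<comment> \<open>Reversing the orientation exchanges heads and tails, which flips the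
      parity.\<close>
    show ?thesis
    proof (rule that[of "\<not> parity"], intro allI impI)
      fix i assume "i < L"
      with alt have "if even i = parity then (x i, x (i + L - 1)) \<in> D' \<and> (x i, x (i + 1)) \<in> D'
                   else (x (i + L - 1), x i) \<in> D' \<and> (x (i + 1), x i) \<in> D'" by blast
      then show "if even i = (\<not> parity) then (x i, x (i + L - 1)) \<in> D \<and> (x i, x (i + 1)) \<in> D
                   else (x (i + L - 1), x i) \<in> D \<and> (x (i + 1), x i) \<in> D"
        unfolding D'_eq by (cases "even i"; cases parity) simp_all
    qed
  qed
  have per: "x (i + L) = x i" for i by (simp add: x_def)
  have xmod: "x (i mod L) = x i" for i by (simp add: x_def)
  have alt_all: "if even i = tail_parity then (x i, x (i + 1)) \<in> D \<and> (x (i + 2), x (i + 1)) \<in> D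
      else (x (i + 1), x i) \<in> D \<and> (x (i + 1), x (i + 2)) \<in> D" for i
  proof -
    \<comment> \<open>Since \<open>L\<close> is even, reduction modulo \<open>L\<close> keeps
      parity, so the condition extends from indices below \<open>L\<close> to all.\<close>
    have at: "if even i = tail_parity then (x i, x (i + L - 1)) \<in> D \<and> (x i, x (i + 1)) \<in> D
              else (x (i + L - 1), x i) \<in> D \<and> (x (i + 1), x i) \<in> D" for i
    proof -
      have e1: "even (i mod L) = even i" using L by (simp add: dvd_mod_iff)
      have e2: "x (i mod L + 1) = x (i + 1)"
        by (simp add: x_def mod_simps)
      have e3: "x (i mod L + L - 1) = x (i + L - 1)"
      proof -
        have "(i mod L + (L - 1)) mod L = (i + (L - 1)) mod L" by (simp only: mod_add_left_eq)
        then show ?thesis using L by (simp add: x_def)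
      qed
      have "i mod L < L" using L by simp
      from alt'[rule_format, OF this] show ?thesis
        by (simp only: e1 e2 e3 xmod)
    qed
    have "i + 2 + L - 1 = (i + 1) + L" using L by simp
    then have "x (i + 2 + L - 1) = x (i + 1)" using per by metis
    then show ?thesis using at[of i] at[of "i + 2"] by (auto split: if_splits)
  qed
  have x_eq: "i mod L = j mod L" if "x i = x j" for i j
  proof -
    have lt: "i mod L < length p" "j mod L < length p" using L by (auto simp: L_def)
    then have "map fst p ! (i mod L) = map fst p ! (j mod L)" using that by (simp add: x_def)
    then show ?thesis using nth_eq_iff_index_eq[OF cyc(1)] lt by (metis length_map)
  qed
  \<comment> \<open>If the tails sit at odd positions, a shift by one makes the sequence start at a
    tail.\<close>
  define s :: nat where "s = (if tail_parity then 0 else 1)"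
  define y where "y i = x (i + s)" for i
  have seq: "alternating_sequence D y L"
    unfolding alternating_sequence_def
  proof (intro conjI allI)
    show "y (i + L) = y i" for i
    proof -
      have "i + L + s = i + s + L" by simp
      then show ?thesis unfolding y_def by (simp only: per)
    qed
    show "inj_on y {..<L}"
    proof (rule inj_onI)
      fix i j assume ij: "i \<in> {..<L}" "j \<in> {..<L}" "y i = y j"
      then have "[i + s = j + s] (mod L)" unfolding y_def cong_def by (intro x_eq)
      then have "[i = j] (mod L)" by (simp only: cong_add_rcancel_nat)
      then show "i = j" using ij by (simp add: cong_def)
    qed
    fix i
    have "even (2 * i + s) = tail_parity" by (simp add: s_def)
    then have "(x (2 * i + s), x (2 * i + s + 1)) \<in> D \<and> (x (2 * i + s + 2), x (2 * i + s + 1)) \<in> D"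
      using alt_all[of "2 * i + s"] by simp
    moreover have "2 * i + 1 + s = 2 * i + s + 1" "2 * i + 2 + s = 2 * i + s + 2" by simp_all
    ultimately show "(y (2 * i), y (2 * i + 1)) \<in> D" "(y (2 * i + 2), y (2 * i + 1)) \<in> D"
      unfolding y_def by (simp_all only:)
  qed (use L in auto)
  have set_p: "set p = range (\<lambda>i. (x i, x (Suc i)))"
  proof -
    have nth: "p ! (i mod L) = (x i, x (Suc i))" for i
    proof -
      have "i mod L < L" using L by simp
      then have "snd (p ! (i mod L)) = fst (p ! (Suc (i mod L) mod L))" using cyc(2) by blast
      then show ?thesis by (simp add: x_def prod_eq_iff mod_Suc_eq)
    qed
    show ?thesis
    proof (intro subset_antisym subsetI)
      fix e assume "e \<in> set p"
      then obtain i where "i < L" "e = p ! i" by (auto simp: in_set_conv_nth L_def)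
      then show "e \<in> range (\<lambda>i. (x i, x (Suc i)))" using nth[of i] by auto
    next
      fix e assume "e \<in> range (\<lambda>i. (x i, x (Suc i)))"
      then obtain i where "e = p ! (i mod L)" using nth by auto
      then show "e \<in> set p" using L by (auto simp: L_def)
    qed
  qed
  have "cycle_verts p = range x" by (auto simp: cycle_verts_def set_p image_image)
  also have "\<dots> = range y"
  proof (intro subset_antisym image_subsetI)
    fix i
    have "i + (L - s) + s = i + L" using L by (simp add: s_def)
    then have "y (i + (L - s)) = x i" unfolding y_def using per by metis
    then show "x i \<in> range y" by (metis rangeI)
    show "y i \<in> range x" by (simp add: y_def)
  qed
  finally have "cycle_verts p = range y" .
  moreover have "edges_of (set p) = range (\<lambda>i. {x i, x (Suc i)})"
    by (simp add: edges_of_def set_p image_image)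
  then have "edges_of (set p) = range (\<lambda>i. {y i, y (Suc i)})"
  proof -
    have "range (\<lambda>i. {y i, y (Suc i)}) = range (\<lambda>i. {x i, x (Suc i)})"
    proof (intro subset_antisym image_subsetI)
      fix i
      show "{y i, y (Suc i)} \<in> range (\<lambda>i. {x i, x (Suc i)})"
        by (rule range_eqI[of _ _ "i + s"]) (simp add: y_def)
      have "i + (L - s) + s = i + L" using L by (simp add: s_def)
      moreover from this have "Suc (i + (L - s)) + s = Suc i + L" by simp
      ultimately have "y (i + (L - s)) = x i" "y (Suc (i + (L - s))) = x (Suc i)"
        unfolding y_def using per by metis+
      then show "{x i, x (Suc i)} \<in> range (\<lambda>i. {y i, y (Suc i)})"
        by (intro range_eqI[of _ _ "i + (L - s)"]) (simp only:)
    qed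
    then show ?thesis using \<open>edges_of (set p) = range (\<lambda>i. {x i, x (Suc i)})\<close> by simp
  qed
  ultimately show ?thesis using that seq by (simp add: L_def)
qed

lemma sequence_alternating_cycle:
  assumes X: "pair_graph X" and D: "orientation X G D" and E: "parcs X = D \<union> D\<inverse>"
    and y: "alternating_sequence D y L"
  shows "alternating_cycle X G (map (\<lambda>i. (y i, y (Suc i))) [0..<L])"
proof -
  let ?p = "map (\<lambda>i. (y i, y (Suc i))) [0..<L]"
  have L: "even L" "L > 2" and per: "y (i + L) = y i" and inj: "inj_on y {..<L}"
    and arc: "(y (2 * i), y (2 * i + 1)) \<in> D" "(y (2 * i + 2), y (2 * i + 1)) \<in> D" for i
    using y by (auto simp: alternating_sequence_def)
  have wrap: "y ((i + L - 1) mod L) = y (i + L - 1)" "y (Suc i mod L) = y (Suc i)" if "i < L" for i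
  proof -
    show "y (Suc i mod L) = y (Suc i)"
      using that per[of 0] by (cases "Suc i = L") auto
    show "y ((i + L - 1) mod L) = y (i + L - 1)"
    proof (cases i)
      case (Suc j)
      then have "i + L - 1 = j + L" by simp
      then show ?thesis using that Suc per[of j] by simp
    qed (use L in simp)
  qed
  have step: "if even i then (y i, y (i + 1)) \<in> D else (y (i + 1), y i) \<in> D" for i
    using arc[of "i div 2"] by (cases "even i") (auto elim!: oddE)
  \<comment> \<open>The predecessor of \<open>i\<close> has index \<open>i + L - 1\<close>, of the
    other parity because \<open>L\<close> is even.\<close>
  have wrap_step: "if even i then (y i, y (i + L - 1)) \<in> D else (y (i + L - 1), y i) \<in> D" for i
  proof -
    have "i + L - 1 + 1 = i + L" "even (i + L - 1) \<longleftrightarrow> odd i" using L by auto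
    then show ?thesis using step[of "i + L - 1"] per[of i] by auto
  qed
  have "set ?p \<subseteq> parcs X" using step E by (fastforce split: if_splits)
  moreover have "distinct (map fst ?p)"
    using inj by (simp add: comp_def distinct_map atLeast0LessThan)
  moreover have "\<forall>i < length ?p. snd (?p ! i) = fst (?p ! (Suc i mod length ?p))"
    using L wrap by simp
  ultimately have "pre_digraph.cycle (with_proj X) ?p"
    using cycle_conv_nth[OF X, of ?p] L by simp
  moreover have "\<forall>i < length ?p.
         let u = fst (?p ! ((i + length ?p - 1) mod length ?p));
             v = fst (?p ! i);
             w = fst (?p ! ((i + 1) mod length ?p))
         in if even i = True
            then (v, u) \<in> D \<and> (v, w) \<in> D
            else (u, v) \<in> D \<and> (w, v) \<in> D"
  proof (intro allI impI)
    fix i assume "i < length ?p"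
    then have i: "i < L" by simp
    then have "L > 0" by simp
    then have "fst (?p ! ((i + length ?p - 1) mod length ?p)) = y (i + L - 1)"
      "fst (?p ! i) = y i" "fst (?p ! ((i + 1) mod length ?p)) = y (i + 1)"
      using i wrap[OF i] by simp_all
    then show "let u = fst (?p ! ((i + length ?p - 1) mod length ?p));
             v = fst (?p ! i);
             w = fst (?p ! ((i + 1) mod length ?p))
         in if even i = True
            then (v, u) \<in> D \<and> (v, w) \<in> D
            else (u, v) \<in> D \<and> (w, v) \<in> D"
      using step[of i] wrap_step[of i] unfolding Let_def by (cases "even i") simp_all
  qed
  ultimately show ?thesis
    using L D unfolding alternating_cycle_def
    by (intro conjI exI[of _ D] exI[of _ True]) (assumption | simp)+
qed

lemma range_even_odd: "range f = range (\<lambda>i. f (2 * i)) \<union> range (\<lambda>i. f (2 * i + 1))"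
  for f :: "nat \<Rightarrow> 'b"
proof
  show "range f \<subseteq> range (\<lambda>i. f (2 * i)) \<union> range (\<lambda>i. f (2 * i + 1))"
  proof (rule image_subsetI)
    fix i show "f i \<in> range (\<lambda>i. f (2 * i)) \<union> range (\<lambda>i. f (2 * i + 1))"
    proof (cases "even i")
      case True
      then have "f i = f (2 * (i div 2))" by simp
      then show ?thesis by (intro UnI1 range_eqI)
    next
      case False
      then have "f i = f (2 * (i div 2) + 1)" by simp
      then show ?thesis by (intro UnI2 range_eqI)
    qed
  qed
  show "range (\<lambda>i. f (2 * i)) \<union> range (\<lambda>i. f (2 * i + 1)) \<subseteq> range f"
    by (intro Un_least image_subsetI) (rule rangeI)+
qed

section \<open>Radius, attachment number and the isomorphism\<close>

theorem theorem2p2: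
  fixes X :: "'a pair_pre_digraph" and G :: "('a \<Rightarrow> 'a) set"
  assumes "pair_graph X"
    and "connected (with_proj X)"
    and "\<forall>v \<in> pverts X. out_degree (with_proj X) v = 4"
    and "half_arc_transitive X G"
    and "tightly_attached X G"
    and "even (radius X G)"
    and "radius X G \<ge> 4"
  shows "\<exists>(m::nat) (n::nat) (r::int) (t::int).
           even m \<and> m \<ge> 4 \<and> even n \<and> n \<ge> 4 \<and>
           r \<in> {0..<int n} \<and> coprime r (int n) \<and> t \<in> {0..<int n} \<and>
           [r ^ m = 1] (mod int n) \<and>
           [t * (r - 1) = 0] (mod int n) \<and>
           [(\<Sum>i = 0..m - 1. r ^ i) + 2 * t = 0] (mod int n) \<and>
           digraph_iso (with_proj X) (with_proj (Xe m n r t))"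
proof -
  note X = assms(1)
  let ?V = "pverts X"
  obtain D where dig: "half_arc_digraph ?V D (extend ?V ` G)" and E: "parcs X = D \<union> D\<inverse>"
    and ori: "orientation X G D" "\<And>D'. orientation X G D' \<Longrightarrow> D' = D \<or> D' = D\<inverse>"
    using half_arc_digraph_orientation[OF assms(1-4)] by blast
  interpret half_arc_digraph ?V D "extend ?V ` G" by (rule dig)
  \<comment> \<open>Alternating cycles given as lists correspond to tail classes;
    \<open>cycle_ex\<close> is the converse direction.\<close>
  have cycleD: "\<exists>u\<in>?V. length p = 2 * card (T u) \<and> cycle_verts p = cycle_set u \<and>
      edges_of (set p) = edges_of (D \<inter> T u \<times> UNIV)" if p: "alternating_cycle X G p" for p
  proof -
    obtain y where y: "alternating_sequence D y (length p)" "cycle_verts p = range y"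
      "edges_of (set p) = range (\<lambda>i. {y i, y (Suc i)})"
      using alternating_cycle_sequence[OF X p ori(2)] by blast
    note cls = alternating_sequence_class[OF y(1)]
    have "(y (2 * 0), y (2 * 0 + 1)) \<in> D" using y(1) unfolding alternating_sequence_def by blast
    from arc_V[OF this] have "y 0 \<in> ?V" by simp
    moreover have "cycle_verts p = cycle_set (y 0)"
      unfolding y(2) cls(2) unfolding cls(1) by (rule range_even_odd)
    moreover have "edges_of (set p) = edges_of (D \<inter> T (y 0) \<times> UNIV)"
    proof -
      define f where "f i = {y i, y (Suc i)}" for i
      have "f (2 * i) = {y (2 * i), y (2 * i + 1)}" "f (2 * i + 1) = {y (2 * i + 2), y (2 * i + 1)}" for i
        by (auto simp: f_def)
      then have "range f =
          range (\<lambda>i. {y (2 * i), y (2 * i + 1)}) \<union> range (\<lambda>i. {y (2 * i + 2), y (2 * i + 1)})"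
        using range_even_odd[of f] by simp
      then show ?thesis
        unfolding y(3) cls(4) by (simp add: edges_of_def image_Un image_image f_def[abs_def])
    qed
    ultimately show ?thesis using cls(3) by blast
  qed
  have cycle_ex: "\<exists>p. alternating_cycle X G p \<and> length p = 2 * card (T z) \<and>
      cycle_verts p = cycle_set z \<and> edges_of (set p) = edges_of (D \<inter> T z \<times> UNIV)"
    if z: "z \<in> ?V" for z
  proof -
    obtain y where y: "alternating_sequence D y (2 * card (T z))" "y 0 = z"
      using exists_alternating_sequence[OF z] by blast
    let ?p = "map (\<lambda>i. (y i, y (Suc i))) [0..<2 * card (T z)]"
    have alt: "alternating_cycle X G ?p"
      by (rule sequence_alternating_cycle[OF X ori(1) E y(1)])
    then obtain u where u: "length ?p = 2 * card (T u)" "cycle_verts ?p = cycle_set u"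
      "edges_of (set ?p) = edges_of (D \<inter> T u \<times> UNIV)"
      using cycleD by blast
    have "2 * card (T z) > 0" using y(1) by (simp add: alternating_sequence_def)
    \<comment> \<open>The class of the \<open>u\<close> from \<open>cycleD\<close> is identified
      with that of \<open>z\<close> through the first edge, whose direction asymmetry fixes.\<close>
    then have "(y 0, y 1) \<in> set ?p" by force
    then have "{z, y 1} \<in> edges_of (set ?p)"
      unfolding edges_of_def y(2) by (rule rev_image_eqI) simp
    then obtain a b where ab: "{z, y 1} = {a, b}" "(a, b) \<in> D" "a \<in> T u"
      unfolding u(3) by (auto simp: edges_of_def)
    have "(y (2 * 0), y (2 * 0 + 1)) \<in> D" using y(1) unfolding alternating_sequence_def by blast
    then have "(z, y 1) \<in> D" using y(2) by simp
    then have "a = z" using ab asymmetric by (auto simp: doubleton_eq_iff)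
    then have "T z = T u" using ab tail_class_eq by metis
    then show ?thesis using alt u by (intro exI[of _ ?p]) simp
  qed
  obtain z where z: "z \<in> ?V" using V_nonempty by blast
  define n where "n = card (T z)"
  have card_T: "card (T x) = n" if "x \<in> ?V" for x
    using card_tail_class[OF that z] by (simp add: n_def)
  have radius: "radius X G = n"
    unfolding radius_def
  proof (rule the_equality)
    show "\<exists>p. alternating_cycle X G p \<and> length p = 2 * n"
      using cycle_ex[OF z] by (auto simp: n_def)
    show "r = n" if r: "\<exists>p. alternating_cycle X G p \<and> length p = 2 * r" for r
    proof -
      obtain p where p: "alternating_cycle X G p" "length p = 2 * r" using r by blast
      then obtain u where "u \<in> ?V" "length p = 2 * card (T u)" using cycleD by blast
      then show ?thesis using card_T p by simp
    qed
  qed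
  have attachment: "attachment_number X G = card (common z)"
    unfolding attachment_number_def
  proof (rule the_equality)
    \<comment> \<open>An in-neighbour of \<open>z\<close> gives a second cycle, on which
      \<open>z\<close> is a head, so adjacent cycles exist.\<close>
    obtain w where w: "(w, z) \<in> D"
      using half_arc_digraph.out_arc[OF dual z] by auto
    then have wV: "w \<in> ?V" using arc_V by blast
    obtain p where p: "alternating_cycle X G p" "cycle_verts p = cycle_set z"
      "edges_of (set p) = edges_of (D \<inter> T z \<times> UNIV)" using cycle_ex[OF z] by blast
    obtain q where q: "alternating_cycle X G q" "cycle_verts q = cycle_set w"
      "edges_of (set q) = edges_of (D \<inter> T w \<times> UNIV)" using cycle_ex[OF wV] by blast
    have zw: "z \<in> D `` T w" using w tail_class_self[of w D] by blast
    then have "z \<notin> T w" using disjoint_out_tail_class[OF wV] by blast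
    then have neq: "edges_of (D \<inter> T z \<times> UNIV) \<noteq> edges_of (D \<inter> T w \<times> UNIV)"
      using edges_from_tail_class z by blast
    have meet: "cycle_set z \<inter> cycle_set w \<noteq> {}" using zw tail_class_self[of z D] by blast
    have "adjacent_alternating_cycles X G p q"
      using p q neq meet by (simp add: adjacent_alternating_cycles_def)
    moreover obtain z' where "z' \<in> ?V" "cycle_set z \<inter> cycle_set w = common z'"
      using adjacent_common[OF _ z wV meet] neq by metis
    then have "card (cycle_verts p \<inter> cycle_verts q) = card (common z)"
      using p q card_common z by metis
    ultimately show "\<exists>p q. adjacent_alternating_cycles X G p q \<and>
        card (cycle_verts p \<inter> cycle_verts q) = card (common z)" by blast
  next
    fix a assume "\<exists>p q. adjacent_alternating_cycles X G p q \<and>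
        card (cycle_verts p \<inter> cycle_verts q) = a"
    then obtain p q where pq: "alternating_cycle X G p" "alternating_cycle X G q"
      "edges_of (set p) \<noteq> edges_of (set q)" "cycle_verts p \<inter> cycle_verts q \<noteq> {}"
      "card (cycle_verts p \<inter> cycle_verts q) = a"
      by (auto simp: adjacent_alternating_cycles_def)
    obtain b where b: "b \<in> ?V" "cycle_verts p = cycle_set b"
      "edges_of (set p) = edges_of (D \<inter> T b \<times> UNIV)" using cycleD[OF pq(1)] by blast
    obtain c where c: "c \<in> ?V" "cycle_verts q = cycle_set c"
      "edges_of (set q) = edges_of (D \<inter> T c \<times> UNIV)" using cycleD[OF pq(2)] by blast
    have "D \<inter> T b \<times> UNIV \<noteq> D \<inter> T c \<times> UNIV" using pq(3) b(3) c(3) by metis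
    then obtain z' where "z' \<in> ?V" "cycle_set b \<inter> cycle_set c = common z'"
      using adjacent_common[OF _ b(1) c(1)] pq(4) b(2) c(2) by metis
    then show "a = card (common z)" using pq(5) b(2) c(2) card_common z by metis
  qed
  have tight: "card (common x) = card (T x)" if "x \<in> ?V" for x
    using assms(5) radius attachment card_common[OF that z] card_T[OF that]
    by (simp add: tightly_attached_def)
  have n: "n \<ge> 4" "even n" using assms(6,7) radius by auto
  interpret tight_digraph ?V D "extend ?V ` G" n
    by unfold_locales (use n card_T tightly_attached_classes tight in auto)
  obtain m r t c where mrt: "even m" "m \<ge> 4" "r \<in> {0..<int n}" "coprime r (int n)" "t \<in> {0..<int n}"
    "[r ^ m = 1] (mod int n)" "[t * (r - 1) = 0] (mod int n)"
    "[(\<Sum>i = 0..m - 1. r ^ i) + 2 * t = 0] (mod int n)"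
    and c: "bij_betw c ({0..<m} \<times> {0..<int n}) ?V"
    and c_arcs: "(\<lambda>(p, q). (c p, c q)) ` Xe_half_arcs m n r t = D"
    using coordinates by blast
  let ?W = "{0..<m} \<times> {0..<int n}"
  have half_W: "Xe_half_arcs m n r t \<subseteq> ?W \<times> ?W"
    using mrt n by (auto simp: Xe_half_arcs_def)
  \<comment> \<open>Coordinates run from index pairs to vertices of \<open>X\<close>; the
    isomorphism goes the other way.\<close>
  define f where "f = inv_into ?W c"
  have f: "bij_betw f ?V ?W" unfolding f_def using c by (rule bij_betw_inv_into)
  have fc: "f (c w) = w" if "w \<in> ?W" for w
    unfolding f_def using c that by (simp add: bij_betw_def)
  let ?h = "\<lparr>iso_verts = f, iso_arcs = map_prod f f, iso_head = snd, iso_tail = fst\<rparr>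
    :: ('a, 'a \<times> 'a, nat \<times> int, (nat \<times> int) \<times> (nat \<times> int)) digraph_isomorphism"
  have "pre_digraph.digraph_isomorphism (with_proj X) ?h"
  proof -
    interpret X: pair_graph X by (rule X)
    have "inj_on (map_prod f f) (?V \<times> ?V)"
      using f by (intro map_prod_inj_on) (auto simp: bij_betw_def)
    then have "inj_on (map_prod f f) (parcs X)"
      by (rule inj_on_subset) (auto dest: X.in_arcsD1 X.in_arcsD2)
    then show ?thesis
      unfolding pre_digraph.digraph_isomorphism_def
      using f X.wf_digraph by (auto simp: bij_betw_def)
  qed
  moreover have "with_proj (Xe m n r t) = app_iso ?h (with_proj X)"
  proof -
    have "map_prod f f ` D = (\<lambda>(p, q). (f (c p), f (c q))) ` Xe_half_arcs m n r t"
      unfolding c_arcs[symmetric] by (auto simp: image_image split_beta)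
    also have "\<dots> = (\<lambda>e. e) ` Xe_half_arcs m n r t"
      by (rule image_cong) (use half_W fc in auto)
    finally have D: "map_prod f f ` D = Xe_half_arcs m n r t" by simp
    \<comment> \<open>Reversal commutes with the vertex map, so matching \<open>D\<close> with the
      half arcs matches all arcs.\<close>
    have "map_prod f f ` (D\<inverse>) = (map_prod f f ` D)\<inverse>" by force
    then have "map_prod f f ` parcs X = Xe_half_arcs m n r t \<union> (Xe_half_arcs m n r t)\<inverse>"
      unfolding E image_Un by (simp add: D)
    then show ?thesis
      using f by (simp add: Xe_def app_iso_def with_proj_def bij_betw_def)
  qed
  ultimately have "digraph_iso (with_proj X) (with_proj (Xe m n r t))"
    unfolding digraph_iso_def by blast
  then show ?thesis using mrt n by blast
qed

end
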